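(* Let $\pi$ be a set of primes and $(B,+,\circ)$ a finite supersoluble skew brace. If $Q$ is any left ideal of $B$ whose order is a $\pi$-number, then $Q$ is contained in a Hall $\pi$-sub-skew brace of $B$.
   Context: A skew (left) brace is a triple $(B,+,\circ)$ where $(B,+)$ and $(B,\circ)$ are (not necessarily abelian) groups with $a\circ(b+c)=a\circ b-a+a\circ c$ for all $a,b,c\in B$. The map $\lambda:(B,\circ)\to\operatorname{Aut}(B,+)$, $a\mapsto\lambda_a$, with $\lambda_a(b)=-a+a\circ b$, is a group homomorphism. A sub-skew brace of $B$ is a subset that is a subgroup of both $(B,+)$ and $(B,\circ)$. A left ideal of $B$ is a subgroup $L$ of $(B,+)$ with $\lambda_a(L)\subseteq L$ for all $a\in B$. An ideal of $B$ is a left ideal that is a normal subgroup of both $(B,+)$ and $(B,\circ)$. A finite skew brace $B$ is supersoluble if it has a finite chain of ideals $\{0\}=I_0\leq I_1\leq\ldots\leq I_n=B$ such that every factor $I_{j+1}/I_j$ has prime order. A $\pi$-number is a positive integer all of whose prime divisors lie in $\pi$. A Hall $\pi$-sub-skew brace of a finite skew brace $B$ is a sub-skew brace whose order is the largest $\pi$-number dividing $|B|$. *)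

theory Defs
  imports "HOL-Algebra.QuotRing" "HOL-Computational_Algebra.Primes"
begin

text \<open>
  A skew brace is carried by the ring record type: \<open>\<oplus>\<close> is the additive group operation
  (not assumed commutative) and \<open>\<otimes>\<close> is the circle operation. The two identities \<open>\<zero>\<close> and \<open>\<one>\<close>
  are not assumed equal; their equality follows from the brace law.
\<close>

locale skew_brace =
  additive: group "add_monoid B" + circle: group B
  for B :: "('a, 'b) ring_scheme" (structure) +
  assumes brace_law:
    "\<lbrakk>a \<in> carrier B; b \<in> carrier B; c \<in> carrier B\<rbrakk>
      \<Longrightarrow> a \<otimes> (b \<oplus> c) = ((a \<otimes> b) \<ominus> a) \<oplus> (a \<otimes> c)"

definition brace_lambda :: "('a, 'b) ring_scheme \<Rightarrow> 'a \<Rightarrow> 'a \<Rightarrow> 'a" where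
  "brace_lambda B a b = (\<ominus>\<^bsub>B\<^esub> a) \<oplus>\<^bsub>B\<^esub> (a \<otimes>\<^bsub>B\<^esub> b)"

definition sub_skew_brace :: "'a set \<Rightarrow> ('a, 'b) ring_scheme \<Rightarrow> bool" where
  "sub_skew_brace H B \<longleftrightarrow> subgroup H (add_monoid B) \<and> subgroup H B"

definition left_brace_ideal :: "'a set \<Rightarrow> ('a, 'b) ring_scheme \<Rightarrow> bool" where
  "left_brace_ideal L B \<longleftrightarrow>
     subgroup L (add_monoid B) \<and> (\<forall>a\<in>carrier B. brace_lambda B a ` L \<subseteq> L)"

definition brace_ideal :: "'a set \<Rightarrow> ('a, 'b) ring_scheme \<Rightarrow> bool" where
  "brace_ideal I B \<longleftrightarrow> left_brace_ideal I B \<and> I \<lhd> add_monoid B \<and> I \<lhd> B"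

text \<open>
  \<open>Quot\<close> is the library's factor construction on ring records. Its carrier is the set of additive
  cosets, and its operations are those induced on cosets by \<open>\<oplus>\<close> and \<open>\<otimes>\<close>, so for an ideal of a
  skew brace it yields the factor skew brace.
\<close>

definition supersoluble :: "('a, 'b) ring_scheme \<Rightarrow> bool" where
  "supersoluble B \<longleftrightarrow>
     (\<exists>(n::nat) I. I 0 = {\<zero>\<^bsub>B\<^esub>} \<and> I n = carrier B \<and>
        (\<forall>j\<le>n. brace_ideal (I j) B) \<and>
        (\<forall>j<n. I j \<subseteq> I (Suc j) \<and>
           Factorial_Ring.prime (order (B\<lparr>carrier := I (Suc j)\<rparr> Quot I j))))"

definition pi_number :: "nat set \<Rightarrow> nat \<Rightarrow> bool" where
  "pi_number \<pi> n \<longleftrightarrow> n > 0 \<and> (\<forall>p. Factorial_Ring.prime p \<and> p dvd n \<longrightarrow> p \<in> \<pi>)"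

definition hall_sub_skew_brace :: "nat set \<Rightarrow> 'a set \<Rightarrow> ('a, 'b) ring_scheme \<Rightarrow> bool" where
  "hall_sub_skew_brace \<pi> H B \<longleftrightarrow>
     sub_skew_brace H B \<and> card H = Max {d. pi_number \<pi> d \<and> d dvd order B}"

end

theory Submission
  imports Defs "HOL-Number_Theory.Cong" "HOL-Algebra.Multiplicative_Group"
begin

text \<open>
  Let \<open>I\<^sub>0 \<le> \<dots> \<le> I\<^sub>n\<close> be a chain of ideals of \<open>B\<close> with factors of prime order. Going down the chain one
  builds sub-skew braces \<open>H\<^sub>j\<close> that contain both \<open>Q\<close> and \<open>I\<^sub>j\<close> and for which \<open>|H\<^sub>j : I\<^sub>j|\<close> is the
  largest \<open>\<pi>\<close>-number dividing \<open>|B : I\<^sub>j|\<close>. The start is \<open>H\<^sub>n = B\<close>, and \<open>H\<^sub>0\<close> is the required Hall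
  sub-skew brace. If the factor \<open>I\<^bsub>j+1\<^esub>/I\<^sub>j\<close> has order \<open>p \<in> \<pi>\<close>, then \<open>H\<^sub>j = H\<^bsub>j+1\<^esub>\<close>. Otherwise the
  factor \<open>I/N\<close> of order \<open>p\<close> must be cut off from a skew brace in which \<open>I\<close> has an index \<open>m\<close> prime
  to \<open>p\<close>: there must be a sub-skew brace of order \<open>m |N|\<close> that contains \<open>N\<close> and \<open>Q\<close>. This is
  lemma \<open>exists_sub_skew_brace_complement\<close>, and it is the core of the proof.

  Both groups of the skew brace act on \<open>I/N\<close>, which is identified with the integers modulo \<open>p\<close>
  through a homomorphism \<open>\<theta>\<close>; the action is by scalars \<open>\<chi>\<close> (additive conjugation) and \<open>\<mu>\<close>
  (the maps \<open>\<lambda>\<close>). Additive complements of \<open>I\<close> modulo \<open>N\<close> are the kernels of crossed homomorphisms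
  \<open>\<delta>\<close> for \<open>\<chi>\<close> that extend \<open>\<theta>\<close>. One exists by averaging over the cosets of \<open>I\<close>
  (\<open>crossed_hom_extension\<close>), two of them differ by a principal crossed homomorphism
  \<open>a \<mapsto> (1 - \<chi> a) t\<close> (\<open>crossed_hom_principal\<close>), and for the same reason \<open>\<delta>\<close> can be chosen to
  vanish on \<open>Q\<close>. Each \<open>\<delta> \<circ> \<lambda>\<^sub>a\<close>, divided by \<open>\<mu> a\<close>, is again such a crossed homomorphism, hence
  \<open>\<delta> (\<lambda>\<^sub>a b) = \<mu> a \<delta> b + (1 - \<chi> b) f a\<close> for some function \<open>f\<close>. If the last term always vanishes,
  the kernel of \<open>\<delta>\<close> is a left ideal and hence the desired sub-skew brace. Otherwise \<open>f\<close> is itself a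
  crossed homomorphism of the circle group for \<open>\<mu>\<close>, and it is a multiple \<open>\<kappa> \<theta>\<close> of \<open>\<theta>\<close> on \<open>I\<close>.

  If \<open>\<kappa> = 0\<close>, then \<open>f\<close> is principal and \<open>\<delta>\<close> can be corrected so that the first case applies. If
  \<open>\<kappa> \<noteq> 0\<close>, then the kernel \<open>C\<close> of \<open>f\<close> is a complement of \<open>I\<close> modulo \<open>N\<close> in the circle group that
  stabilises \<open>K = ker \<delta>\<close> under \<open>\<lambda>\<close>. It also permutes the additive cosets of \<open>K\<close>, of which there
  are \<open>p\<close>, by affine maps modulo \<open>p\<close>, and it has a fixed point, again by \<open>crossed_hom_principal\<close>.
  A fixed coset \<open>i + K\<close> with \<open>i \<in> I\<close> satisfies \<open>C \<circ> i = i + K\<close>, so that the circle subgroup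
  \<open>i\<^sup>- \<circ> C \<circ> i\<close>, where \<open>i\<^sup>-\<close> is the circle inverse of \<open>i\<close>, equals the additive subgroup
  \<open>\<lambda>\<^sub>i\<^sup>-\<^sup>1(K)\<close>. This set is the sub-skew brace sought (\<open>kernel_translate_sub_skew_brace\<close>); it contains
  \<open>N\<close> and \<open>Q\<close> because \<open>K\<close> does and both are invariant under \<open>\<lambda>\<close>.
\<close>

section \<open>Crossed homomorphisms modulo a prime\<close>

text \<open>
  Congruences as divisibility equations: in this form a consequence of several congruences is an
  ideal membership problem, which Groebner bases decide.
\<close>

lemmas cong_equation = cong_iff_dvd_diff dvd_def

lemma prime_cong_inverse:
  fixes p u :: int
  assumes "Factorial_Ring.prime p" and "\<not> [u = 0] (mod p)"
  obtains v where "[u * v = 1] (mod p)"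
proof -
  have "\<not> p dvd u" using assms(2) by (simp add: cong_0_iff)
  then have "coprime u p" using assms(1) prime_imp_coprime coprime_commute by blast
  then show thesis using that cong_solve_coprime_int by blast
qed

text \<open>
  A crossed homomorphism into the integers modulo \<open>p\<close>, on which the group acts through the scalars
  \<open>\<chi>\<close>. That \<open>\<chi>\<close> is a character is part of the notion. Equivalently, \<open>x\<close> acts as the affine
  map \<open>t \<mapsto> \<chi> x t + d x\<close>.
\<close>
definition crossed_hom :: "int \<Rightarrow> ('a, 'b) monoid_scheme \<Rightarrow> ('a \<Rightarrow> int) \<Rightarrow> ('a \<Rightarrow> int) \<Rightarrow> bool" where
  "crossed_hom p G \<chi> d \<longleftrightarrow>
     [\<chi> \<one>\<^bsub>G\<^esub> = 1] (mod p) \<and>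
     (\<forall>x\<in>carrier G. \<forall>y\<in>carrier G.
        [\<chi> (x \<otimes>\<^bsub>G\<^esub> y) = \<chi> x * \<chi> y] (mod p) \<and> [d (x \<otimes>\<^bsub>G\<^esub> y) = d x + \<chi> x * d y] (mod p))"

lemma crossed_homI:
  assumes "[\<chi> \<one>\<^bsub>G\<^esub> = 1] (mod p)"
    and "\<And>x y. \<lbrakk>x \<in> carrier G; y \<in> carrier G\<rbrakk> \<Longrightarrow> [\<chi> (x \<otimes>\<^bsub>G\<^esub> y) = \<chi> x * \<chi> y] (mod p)"
    and "\<And>x y. \<lbrakk>x \<in> carrier G; y \<in> carrier G\<rbrakk> \<Longrightarrow> [d (x \<otimes>\<^bsub>G\<^esub> y) = d x + \<chi> x * d y] (mod p)"
  shows "crossed_hom p G \<chi> d"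
  using assms unfolding crossed_hom_def by blast

context group
begin

context
  fixes p :: int and \<chi> d :: "'a \<Rightarrow> int"
  assumes d: "crossed_hom p G \<chi> d"
begin

lemma crossed_hom_char_one: "[\<chi> \<one> = 1] (mod p)"
  using d unfolding crossed_hom_def by blast

lemma crossed_hom_char_mult:
  "\<lbrakk>x \<in> carrier G; y \<in> carrier G\<rbrakk> \<Longrightarrow> [\<chi> (x \<otimes> y) = \<chi> x * \<chi> y] (mod p)"
  using d unfolding crossed_hom_def by blast

lemma crossed_hom_mult:
  "\<lbrakk>x \<in> carrier G; y \<in> carrier G\<rbrakk> \<Longrightarrow> [d (x \<otimes> y) = d x + \<chi> x * d y] (mod p)"
  using d unfolding crossed_hom_def by blast

lemma crossed_hom_char_inv: "x \<in> carrier G \<Longrightarrow> [\<chi> x * \<chi> (inv x) = 1] (mod p)"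
  using crossed_hom_char_mult[of x "inv x"] crossed_hom_char_one
  by (simp add: cong_sym_eq) (metis cong_trans)

lemma crossed_hom_one: "[d \<one> = 0] (mod p)"
  using crossed_hom_mult[of \<one> \<one>] crossed_hom_char_one
  unfolding cong_equation by simp Groebner_Basis.algebra

lemma crossed_hom_inv: "x \<in> carrier G \<Longrightarrow> [d (inv x) = - \<chi> (inv x) * d x] (mod p)"
  using crossed_hom_mult[of "inv x" x] crossed_hom_one
  unfolding cong_equation by simp Groebner_Basis.algebra

lemma crossed_hom_pow:
  assumes "x \<in> carrier G" and "[\<chi> x = 1] (mod p)"
  shows "[d (x [^] (n::nat)) = int n * d x] (mod p)"
proof (induction n)
  case 0
  then show ?case using crossed_hom_one by simp
next
  case (Suc n)
  have "[\<chi> (x [^] n) = 1] (mod p)"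
  proof (induction n)
    case 0
    then show ?case using crossed_hom_char_one by simp
  next
    case (Suc n)
    then show ?case
      using crossed_hom_char_mult[of "x [^] n" x] assms
      unfolding cong_equation by simp Groebner_Basis.algebra
  qed
  then show ?case
    using crossed_hom_mult[of "x [^] n" x] assms Suc
    unfolding cong_equation by (simp add: algebra_simps) Groebner_Basis.algebra
qed

lemma crossed_hom_kernel_subgroup: "subgroup {x \<in> carrier G. [d x = 0] (mod p)} G"
proof (rule subgroupI)
  fix x y
  assume "x \<in> {x \<in> carrier G. [d x = 0] (mod p)}" "y \<in> {x \<in> carrier G. [d x = 0] (mod p)}"
  then show "x \<otimes> y \<in> {x \<in> carrier G. [d x = 0] (mod p)}"
    using crossed_hom_mult[of x y] unfolding cong_equation by simp Groebner_Basis.algebra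
next
  fix x
  assume "x \<in> {x \<in> carrier G. [d x = 0] (mod p)}"
  then show "inv x \<in> {x \<in> carrier G. [d x = 0] (mod p)}"
    using crossed_hom_inv[of x] unfolding cong_equation by simp Groebner_Basis.algebra
qed (use crossed_hom_one in auto)

text \<open>
  The affine maps \<open>t \<mapsto> \<chi> x t + d x\<close> form a group without nontrivial translations, by the torsion
  hypothesis. So either all of them are trivial, or some \<open>g\<close> with \<open>\<chi> g \<noteq> 1\<close> has a unique fixed
  point \<open>t\<close>. Commutators act as translations, hence trivially; every element therefore commutes
  with \<open>g\<close> in its action and fixes \<open>t\<close> too. This is the vanishing of a first cohomology group and
  takes the place of all conjugacy arguments for complements.
\<close>
lemma crossed_hom_principal:
  assumes p: "Factorial_Ring.prime p"
    and tors: "\<And>x. x \<in> carrier G \<Longrightarrow> [\<chi> x = 1] (mod p) \<Longrightarrow>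
      \<exists>k::nat. \<not> [int k = 0] (mod p) \<and> [d (x [^] k) = 0] (mod p)"
  shows "\<exists>t. \<forall>x\<in>carrier G. [d x = (1 - \<chi> x) * t] (mod p)"
proof -
  have van: "[d x = 0] (mod p)" if x: "x \<in> carrier G" "[\<chi> x = 1] (mod p)" for x
  proof -
    obtain k :: nat where k: "\<not> [int k = 0] (mod p)" "[d (x [^] k) = 0] (mod p)"
      using tors x by blast
    have "[int k * d x = 0] (mod p)" using crossed_hom_pow[OF x] k(2) cong_sym cong_trans by blast
    then show ?thesis using k(1) p by (simp add: cong_0_iff prime_dvd_mult_iff)
  qed
  show ?thesis
  proof (cases "\<forall>x\<in>carrier G. [\<chi> x = 1] (mod p)")
    case True
    then have "\<forall>x\<in>carrier G. [d x = (1 - \<chi> x) * 0] (mod p)" using van by simp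
    then show ?thesis by blast
  next
    case False
    then obtain g where g: "g \<in> carrier G" "\<not> [\<chi> g = 1] (mod p)" by blast
    have "\<not> [1 - \<chi> g = 0] (mod p)" using g(2) by (simp add: cong_iff_dvd_diff dvd_diff_commute)
    then obtain v where v: "[(1 - \<chi> g) * v = 1] (mod p)" using prime_cong_inverse[OF p] by blast
    have "[d x = (1 - \<chi> x) * (d g * v)] (mod p)" if x: "x \<in> carrier G" for x
    proof -
      define k where "k = (g \<otimes> x) \<otimes> inv (x \<otimes> g)"
      have k: "k \<in> carrier G" "k \<otimes> (x \<otimes> g) = g \<otimes> x"
        using g x by (auto simp: k_def m_assoc)
      have "[\<chi> k = 1] (mod p)"
        using crossed_hom_char_mult[OF g(1) x] crossed_hom_char_mult[OF x g(1)]
          crossed_hom_char_mult[OF k(1) m_closed[OF x g(1)], unfolded k(2)]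
          crossed_hom_char_inv[OF m_closed[OF x g(1)]]
        unfolding cong_equation by Groebner_Basis.algebra
      then have "[d k = 0] (mod p)" "[\<chi> k = 1] (mod p)" using van k by auto
      then have "[d (g \<otimes> x) = d (x \<otimes> g)] (mod p)"
        using crossed_hom_mult[OF k(1) m_closed[OF x g(1)], unfolded k(2)]
        unfolding cong_equation by Groebner_Basis.algebra
      then show ?thesis
        using crossed_hom_mult[OF g(1) x] crossed_hom_mult[OF x g(1)] v
        unfolding cong_equation by Groebner_Basis.algebra
    qed
    then show ?thesis by blast
  qed
qed

lemma crossed_hom_add_principal: "crossed_hom p G \<chi> (\<lambda>x. d x + (1 - \<chi> x) * t)"
proof (rule crossed_homI)
  fix x y assume "x \<in> carrier G" "y \<in> carrier G"
  then show "[d (x \<otimes> y) + (1 - \<chi> (x \<otimes> y)) * t = d x + (1 - \<chi> x) * t + \<chi> x * (d y + (1 - \<chi> y) * t)] (mod p)"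
    using crossed_hom_mult[of x y] crossed_hom_char_mult[of x y]
    unfolding cong_equation by simp Groebner_Basis.algebra
qed (use crossed_hom_char_one crossed_hom_char_mult in auto)

lemma crossed_hom_subgroup:
  assumes "subgroup H G"
  shows "crossed_hom p (G\<lparr>carrier := H\<rparr>) \<chi> d"
  using d subgroup.subset[OF assms] unfolding crossed_hom_def by auto

text \<open>
  The level sets of \<open>d\<close> are translates \<open>r k \<otimes> ker d\<close> of the kernel by elements with
  \<open>\<chi> (r k) = 1\<close> and \<open>d (r k) = k\<close>.
\<close>
lemma card_crossed_hom_kernel:
  assumes "p > 0" and "finite (carrier G)"
    and onto: "\<And>k. \<exists>x\<in>carrier G. [\<chi> x = 1] (mod p) \<and> [d x = k] (mod p)"
  shows "card (carrier G) = nat p * card {x \<in> carrier G. [d x = 0] (mod p)}"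
proof -
  obtain r where r: "\<And>k. r k \<in> carrier G" "\<And>k. [\<chi> (r k) = 1] (mod p)" "\<And>k. [d (r k) = k] (mod p)"
    using onto by metis
  let ?K = "{x \<in> carrier G. [d x = 0] (mod p)}"
  have val: "[d (r k \<otimes> x) = k] (mod p)" if "x \<in> ?K" for k x
    using crossed_hom_mult[of "r k" x] r[of k] that unfolding cong_equation by simp Groebner_Basis.algebra
  have "bij_betw (\<lambda>(k, x). r k \<otimes> x) ({0..<p} \<times> ?K) (carrier G)"
  proof (rule bij_betw_imageI)
    show "inj_on (\<lambda>(k, x). r k \<otimes> x) ({0..<p} \<times> ?K)"
    proof (rule inj_onI, clarsimp)
      fix k x l y
      assume kl: "0 \<le> k" "k < p" "0 \<le> l" "l < p"
        and xy: "x \<in> carrier G" "[d x = 0] (mod p)" "y \<in> carrier G" "[d y = 0] (mod p)"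
        and eq: "r k \<otimes> x = r l \<otimes> y"
      have "[k = l] (mod p)"
        using val[of x k] val[of y l] eq xy by (simp, metis cong_sym cong_trans)
      then have "k = l" using kl by (simp add: cong_less_imp_eq_int)
      then show "k = l \<and> x = y" using eq r(1)[of l] xy by simp
    qed
  next
    show "(\<lambda>(k, x). r k \<otimes> x) ` ({0..<p} \<times> ?K) = carrier G"
    proof (intro equalityI subsetI)
      fix g assume g: "g \<in> carrier G"
      define k where "k = d g mod p"
      define x where "x = inv (r k) \<otimes> g"
      have x: "x \<in> carrier G" "g = r k \<otimes> x" using g r(1)[of k] by (auto simp: x_def m_assoc[symmetric])
      have "[k = d g] (mod p)" by (simp add: k_def)
      then have "[d x = 0] (mod p)"
        using crossed_hom_mult[OF r(1) x(1), of k, folded x(2)] r(2,3)[of k]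
        unfolding cong_equation by Groebner_Basis.algebra
      moreover have "k \<in> {0..<p}" using assms(1) by (simp add: k_def)
      ultimately show "g \<in> (\<lambda>(k, x). r k \<otimes> x) ` ({0..<p} \<times> ?K)" using x by force
    qed (use r in auto)
  qed
  then have "card ({0..<p} \<times> ?K) = card (carrier G)" by (rule bij_betw_same_card)
  then show ?thesis by (simp add: card_cartesian_product)
qed

end

text \<open>
  Modulo the kernel of \<open>\<theta>\<close> every \<open>x\<close> is the power of \<open>g\<close> with exponent \<open>\<theta> x\<close>. The lemma
  produces the scalars by which automorphisms act on a group of order \<open>p\<close>.
\<close>
lemma hom_mod_prime_scalar:
  assumes th: "\<And>x y. \<lbrakk>x \<in> carrier G; y \<in> carrier G\<rbrakk> \<Longrightarrow> [\<theta> (x \<otimes> y) = \<theta> x + \<theta> y] (mod p)"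
    and ps: "\<And>x y. \<lbrakk>x \<in> carrier G; y \<in> carrier G\<rbrakk> \<Longrightarrow> [\<psi> (x \<otimes> y) = \<psi> x + \<psi> y] (mod p)"
    and ker: "\<And>x. \<lbrakk>x \<in> carrier G; [\<theta> x = 0] (mod p)\<rbrakk> \<Longrightarrow> [\<psi> x = 0] (mod p)"
    and g: "g \<in> carrier G" "[\<theta> g = 1] (mod p)" and x: "x \<in> carrier G" and p: "p > (0::int)"
  shows "[\<psi> x = \<psi> g * \<theta> x] (mod p)"
proof -
  have c: "crossed_hom p G (\<lambda>_. 1) \<theta>" "crossed_hom p G (\<lambda>_. 1) \<psi>"
    using th ps by (auto intro: crossed_homI)
  define k where "k = nat (\<theta> x mod p)"
  have k: "[int k = \<theta> x] (mod p)" using p by (simp add: k_def)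
  define y where "y = x \<otimes> inv (g [^] k)"
  have gk: "g [^] k \<in> carrier G" using g(1) by simp
  have y: "y \<in> carrier G" "x = y \<otimes> g [^] k" using x g by (auto simp: y_def m_assoc)
  have pw: "[\<theta> (g [^] k) = int k * \<theta> g] (mod p)" "[\<psi> (g [^] k) = int k * \<psi> g] (mod p)"
    using crossed_hom_pow[OF c(1) g(1)] crossed_hom_pow[OF c(2) g(1)] by auto
  have "[\<theta> y = 0] (mod p)"
    using th[OF y(1) gk, folded y(2)] g(2) k pw(1) unfolding cong_equation by Groebner_Basis.algebra
  then have "[\<psi> y = 0] (mod p)" using ker y by blast
  then show ?thesis
    using ps[OF y(1) gk, folded y(2)] k pw(2) unfolding cong_equation by Groebner_Basis.algebra
qed

section \<open>Coordinates on a prime factor and their extension\<close>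

lemma pow_index_mem_normal:
  assumes N: "N \<lhd> G" and fin: "finite (carrier G)" and k: "card (carrier G) = k * card N"
    and x: "x \<in> carrier G"
  shows "x [^] (k::nat) \<in> N"
proof -
  interpret N: normal N G by (rule N)
  interpret Q: group "G Mod N" by (rule N.factorgroup_is_group)
  interpret h: group_hom G "G Mod N" "\<lambda>a. N #> a"
    using N.r_coset_hom_Mod by (unfold_locales) auto
  have "card N > 0"
    using fin finite_subset[OF N.subset] N.one_closed card_gt_0_iff by blast
  moreover have "card (rcosets N) * card N = order G"
    using lagrange_finite[OF fin N.subgroup_axioms] by simp
  ultimately have "order (G Mod N) = k"
    using k by (simp add: FactGroup_def order_def)
  moreover have "N #> x \<in> carrier (G Mod N)" using x by simp
  ultimately have "(N #> x) [^]\<^bsub>G Mod N\<^esub> k = \<one>\<^bsub>G Mod N\<^esub>"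
    using Q.pow_order_eq_1 by blast
  then have "N #> (x [^] k) = N"
    using x by (simp add: h.hom_nat_pow[symmetric])
  then show ?thesis
    using rcos_self[of "x [^] k" N] x N.subgroup_axioms by simp
qed

text \<open>
  A group of prime order is cyclic: \<open>\<theta>\<close> is the exponent with respect to a generator of the factor
  group.
\<close>
lemma prime_index_hom:
  assumes N: "N \<lhd> G" and fin: "finite (carrier G)"
    and p: "Factorial_Ring.prime (p::nat)" and card: "card (carrier G) = p * card N"
  obtains \<theta> g where "\<And>x y. \<lbrakk>x \<in> carrier G; y \<in> carrier G\<rbrakk> \<Longrightarrow> [\<theta> (x \<otimes> y) = \<theta> x + \<theta> y] (mod (int p))"
    and "\<And>x. x \<in> carrier G \<Longrightarrow> [\<theta> x = 0] (mod (int p)) \<longleftrightarrow> x \<in> N"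
    and "g \<in> carrier G" "[\<theta> g = 1] (mod (int p))"
proof -
  interpret N: normal N G by (rule N)
  interpret Q: group "G Mod N" by (rule N.factorgroup_is_group)
  interpret h: group_hom G "G Mod N" "\<lambda>a. N #> a"
    using N.r_coset_hom_Mod by (unfold_locales) auto
  have finN: "finite N" using fin finite_subset[OF N.subset] by blast
  then have N0: "card N > 0" using N.one_closed card_gt_0_iff by blast
  moreover have "card (rcosets N) * card N = order G"
    using lagrange_finite[OF fin N.subgroup_axioms] by simp
  ultimately have oQ: "order (G Mod N) = p"
    using card by (simp add: FactGroup_def order_def)
  have "card N < card (carrier G)" using card N0 prime_gt_1_nat[OF p] by simp
  then obtain g where g: "g \<in> carrier G" "g \<notin> N" 
    using N.subset by (metis order_less_irrefl subsetI subset_antisym)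
  define X where "X = N #> g"
  have X: "X \<in> carrier (G Mod N)" using g by (simp add: X_def)
  have ker: "N #> x = \<one>\<^bsub>G Mod N\<^esub> \<longleftrightarrow> x \<in> N" if "x \<in> carrier G" for x
    using that rcos_self[of x N] coset_join2[of x N] N.subgroup_axioms by (auto simp: FactGroup_def)
  have "X \<noteq> \<one>\<^bsub>G Mod N\<^esub>" using ker g by (simp add: X_def)
  moreover have "Q.ord X dvd p" using Q.ord_dvd_group_order[OF X] oQ by simp
  ultimately have oX: "Q.ord X = p"
    using p X Q.ord_eq_1 by (metis prime_nat_iff)
  have "finite (carrier (G Mod N))" using oQ prime_gt_0_nat[OF p] Q.order_gt_0_iff_finite by simp
  moreover have "card (generate (G Mod N) {X}) = order (G Mod N)"
    using Q.generate_pow_card[OF X] oX oQ by simp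
  moreover have "generate (G Mod N) {X} \<subseteq> carrier (G Mod N)" using Q.generate_incl X by blast
  ultimately have gen: "generate (G Mod N) {X} = carrier (G Mod N)"
    by (simp add: card_subset_eq order_def)
  have "\<exists>k::int. N #> x = X [^]\<^bsub>G Mod N\<^esub> k" if "x \<in> carrier G" for x
  proof -
    have "N #> x \<in> generate (G Mod N) {X}" using that gen by simp
    then show ?thesis using Q.generate_pow[OF X] by auto
  qed
  then obtain \<theta> where \<theta>: "\<And>x. x \<in> carrier G \<Longrightarrow> N #> x = X [^]\<^bsub>G Mod N\<^esub> (\<theta> x :: int)" by metis
  have eq: "X [^]\<^bsub>G Mod N\<^esub> k = X [^]\<^bsub>G Mod N\<^esub> l \<longleftrightarrow> [k = l] (mod (int p))" for k l :: int
    using Q.int_pow_eq[OF X] oX by (metis cong_iff_dvd_diff cong_sym_eq)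
  show thesis
  proof (rule that[of \<theta> g])
    fix x y assume xy: "x \<in> carrier G" "y \<in> carrier G"
    have "X [^]\<^bsub>G Mod N\<^esub> (\<theta> (x \<otimes> y)) = X [^]\<^bsub>G Mod N\<^esub> (\<theta> x + \<theta> y)"
      using xy X by (simp add: \<theta>[symmetric] Q.int_pow_mult)
    then show "[\<theta> (x \<otimes> y) = \<theta> x + \<theta> y] (mod (int p))" by (simp add: eq)
  next
    fix x assume x: "x \<in> carrier G"
    have "[\<theta> x = 0] (mod (int p)) \<longleftrightarrow> N #> x = \<one>\<^bsub>G Mod N\<^esub>"
      using eq[of "\<theta> x" 0] \<theta>[OF x] by simp
    then show "[\<theta> x = 0] (mod (int p)) \<longleftrightarrow> x \<in> N" using ker x by simp
  next
    show "[\<theta> g = 1] (mod (int p))"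
      unfolding eq[symmetric] \<theta>[OF g(1), folded X_def, symmetric] using X by simp
  qed (use g in simp)
qed

text \<open>
  This is the transfer argument behind the Schur-Zassenhaus theorem. Choose representatives \<open>r T\<close> of
  the cosets \<open>T\<close> of \<open>P\<close>. The sum over all \<open>T\<close> of \<open>\<theta> (g r(T) r(gT)\<^sup>-\<^sup>1)\<close> is a crossed homomorphism,
  and for \<open>g \<in> P\<close> all \<open>m\<close> summands are equal to \<open>\<theta> g\<close>. Since \<open>m\<close> is invertible modulo
  \<open>p\<close>, it can be divided out.
\<close>
lemma crossed_hom_extension:
  assumes P: "P \<lhd> G" and fin: "finite (carrier G)" and p: "Factorial_Ring.prime p"
    and card: "card (carrier G) = m * card P" and m: "\<not> [int m = 0] (mod p)"
    and \<theta>: "\<And>x y. \<lbrakk>x \<in> P; y \<in> P\<rbrakk> \<Longrightarrow> [\<theta> (x \<otimes> y) = \<theta> x + \<theta> y] (mod p)"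
    and \<chi>: "\<And>g x. \<lbrakk>g \<in> carrier G; x \<in> P\<rbrakk> \<Longrightarrow> [\<theta> (g \<otimes> x \<otimes> inv g) = \<chi> g * \<theta> x] (mod p)"
    and \<chi>1: "[\<chi> \<one> = 1] (mod p)"
    and \<chi>m: "\<And>x y. \<lbrakk>x \<in> carrier G; y \<in> carrier G\<rbrakk> \<Longrightarrow> [\<chi> (x \<otimes> y) = \<chi> x * \<chi> y] (mod p)"
  obtains d where "crossed_hom p G \<chi> d" "\<And>x. x \<in> P \<Longrightarrow> [d x = \<theta> x] (mod p)"
proof -
  interpret P: normal P G by (rule P)
  interpret Q: group "G Mod P" by (rule P.factorgroup_is_group)
  interpret h: group_hom G "G Mod P" "\<lambda>a. P #> a"
    using P.r_coset_hom_Mod by (unfold_locales) auto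
  let ?Q = "carrier (G Mod P)"
  have "finite P" using fin finite_subset[OF P.subset] by blast
  then have "card P > 0" using P.one_closed card_gt_0_iff by blast
  moreover have "card (rcosets P) * card P = order G"
    using lagrange_finite[OF fin P.subgroup_axioms] by simp
  ultimately have cQ: "card ?Q = m"
    using card by (simp add: FactGroup_def order_def)
  define r where "r T = (SOME x. x \<in> carrier G \<and> P #> x = T)" for T
  have r: "r T \<in> carrier G" "P #> r T = T" if "T \<in> ?Q" for T
  proof -
    have "\<exists>x. x \<in> carrier G \<and> P #> x = T" using that by (auto simp: FactGroup_def RCOSETS_def)
    then show "r T \<in> carrier G" "P #> r T = T" unfolding r_def by (metis (mono_tags, lifting) someI_ex)+
  qed
  define s where "s g T = g \<otimes> r T \<otimes> inv (r ((P #> g) \<otimes>\<^bsub>G Mod P\<^esub> T))" for g T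
  have rc: "r ((P #> g) \<otimes>\<^bsub>G Mod P\<^esub> T) \<in> carrier G" if "g \<in> carrier G" "T \<in> ?Q" for g T
    using that by (intro r(1) Q.m_closed) auto
  have s: "s g T \<in> P" if g: "g \<in> carrier G" and T: "T \<in> ?Q" for g T
  proof -
    have gT: "(P #> g) \<otimes>\<^bsub>G Mod P\<^esub> T \<in> ?Q" using g T by (intro Q.m_closed) auto
    have "P #> (g \<otimes> r T) = (P #> g) \<otimes>\<^bsub>G Mod P\<^esub> (P #> r T)" using g r(1)[OF T] by simp
    then have "P #> (g \<otimes> r T) = P #> r ((P #> g) \<otimes>\<^bsub>G Mod P\<^esub> T)" using r(2)[OF T] r(2)[OF gT] by simp
    then have "g \<otimes> r T \<in> P #> r ((P #> g) \<otimes>\<^bsub>G Mod P\<^esub> T)"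
      using rcos_self[of "g \<otimes> r T" P] g r(1)[OF T] P.subgroup_axioms by simp
    then show ?thesis unfolding s_def using P.rcos_module_imp[OF is_group r(1)[OF gT]] by blast
  qed
  have canc: "inv u \<otimes> (u \<otimes> z) = z" if "u \<in> carrier G" "z \<in> carrier G" for u z
    using that by (simp add: m_assoc[symmetric])
  define D where "D g = (\<Sum>T\<in>?Q. \<theta> (s g T))" for g
  have D_mult: "[D (x \<otimes> y) = D x + \<chi> x * D y] (mod p)" if x: "x \<in> carrier G" and y: "y \<in> carrier G" for x y
  proof -
    let ?y = "\<lambda>T. (P #> y) \<otimes>\<^bsub>G Mod P\<^esub> T"
    have yQ: "P #> y \<in> ?Q" "P #> x \<in> ?Q" using x y by auto
    have "[\<theta> (s (x \<otimes> y) T) = \<theta> (s x (?y T)) + \<chi> x * \<theta> (s y T)] (mod p)" if T: "T \<in> ?Q" for T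
    proof -
      have yT: "?y T \<in> ?Q" using yQ T by (intro Q.m_closed)
      have c: "r T \<in> carrier G" "r (?y T) \<in> carrier G" "r ((P #> x) \<otimes>\<^bsub>G Mod P\<^esub> ?y T) \<in> carrier G"
        using r(1)[OF T] r(1)[OF yT] rc[OF x yT] by auto
      have e: "(P #> (x \<otimes> y)) \<otimes>\<^bsub>G Mod P\<^esub> T = (P #> x) \<otimes>\<^bsub>G Mod P\<^esub> ?y T"
        using Q.m_assoc[OF yQ(2,1) T] h.hom_mult[OF x y] by simp
      have "s (x \<otimes> y) T = (x \<otimes> s y T \<otimes> inv x) \<otimes> s x (?y T)"
        unfolding s_def e using c x y by (simp add: m_assoc canc)
      then have "[\<theta> (s (x \<otimes> y) T) = \<theta> (x \<otimes> s y T \<otimes> inv x) + \<theta> (s x (?y T))] (mod p)"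
        using \<theta>[OF P.inv_op_closed2[OF x s[OF y T]] s[OF x yT]] by metis
      then show ?thesis
        using \<chi>[OF x s[OF y T]] unfolding cong_equation by Groebner_Basis.algebra
    qed
    then have "[D (x \<otimes> y) = (\<Sum>T\<in>?Q. \<theta> (s x (?y T)) + \<chi> x * \<theta> (s y T))] (mod p)"
      unfolding D_def by (rule cong_sum)
    also have "(\<Sum>T\<in>?Q. \<theta> (s x (?y T)) + \<chi> x * \<theta> (s y T)) = (\<Sum>T\<in>?Q. \<theta> (s x (?y T))) + \<chi> x * D y"
      by (simp add: D_def sum.distrib sum_distrib_left)
    also have "(\<Sum>T\<in>?Q. \<theta> (s x (?y T))) = D x"
      unfolding D_def
    proof (rule sum.reindex_bij_betw[where h = ?y])
      show "bij_betw ?y ?Q ?Q"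
        by (rule bij_betw_imageI[OF Q.inj_on_cmult[OF yQ(1)] Q.surj_const_mult[OF yQ(1)]])
    qed
    finally show ?thesis .
  qed
  have D_P: "[D x = int m * \<theta> x] (mod p)" if x: "x \<in> P" for x
  proof -
    have xG: "x \<in> carrier G" using x P.subset by blast
    have "s x T = x" if T: "T \<in> ?Q" for T
    proof -
      have "P #> x = \<one>\<^bsub>G Mod P\<^esub>" using coset_join2[OF xG P.subgroup_axioms x] by (simp add: FactGroup_def)
      then have "(P #> x) \<otimes>\<^bsub>G Mod P\<^esub> T = T" using Q.l_one[OF T] by simp
      then show ?thesis unfolding s_def using xG r(1)[OF T] by (simp add: m_assoc)
    qed
    then show ?thesis by (simp add: D_def cQ)
  qed
  obtain v where v: "[int m * v = 1] (mod p)" using prime_cong_inverse[OF p m] by blast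
  show thesis
  proof (rule that[of "\<lambda>g. v * D g"])
    show "crossed_hom p G \<chi> (\<lambda>g. v * D g)"
    proof (rule crossed_homI)
      fix x y assume xy: "x \<in> carrier G" "y \<in> carrier G"
      show "[v * D (x \<otimes> y) = v * D x + \<chi> x * (v * D y)] (mod p)"
        using D_mult[OF xy] unfolding cong_equation by Groebner_Basis.algebra
    qed (use \<chi>1 \<chi>m in auto)
  next
    fix x assume "x \<in> P"
    from D_P[OF this] v show "[v * D x = \<theta> x] (mod p)" 
      unfolding cong_equation by Groebner_Basis.algebra
  qed
qed

end

section \<open>Arithmetic in skew braces\<close>

context skew_brace
begin

lemma add_closed [simp, intro]: "\<lbrakk>x \<in> carrier B; y \<in> carrier B\<rbrakk> \<Longrightarrow> x \<oplus> y \<in> carrier B"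
  and zero_closed [simp, intro]: "\<zero> \<in> carrier B"
  and minus_closed [simp, intro]: "x \<in> carrier B \<Longrightarrow> \<ominus> x \<in> carrier B"
  and zero_add [simp]: "x \<in> carrier B \<Longrightarrow> \<zero> \<oplus> x = x"
  and add_zero [simp]: "x \<in> carrier B \<Longrightarrow> x \<oplus> \<zero> = x"
  and add_minus [simp]: "x \<in> carrier B \<Longrightarrow> x \<oplus> \<ominus> x = \<zero>"
  and minus_add [simp]: "x \<in> carrier B \<Longrightarrow> \<ominus> x \<oplus> x = \<zero>"
  and minus_minus [simp]: "x \<in> carrier B \<Longrightarrow> \<ominus> (\<ominus> x) = x"
  and minus_sum: "\<lbrakk>x \<in> carrier B; y \<in> carrier B\<rbrakk> \<Longrightarrow> \<ominus> (x \<oplus> y) = \<ominus> y \<oplus> \<ominus> x"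
  and add_assoc: "\<lbrakk>x \<in> carrier B; y \<in> carrier B; z \<in> carrier B\<rbrakk> \<Longrightarrow> (x \<oplus> y) \<oplus> z = x \<oplus> (y \<oplus> z)"
  using additive.m_closed[of x y] additive.one_closed additive.inv_closed[of x]
    additive.l_one[of x] additive.r_one[of x] additive.r_inv[of x] additive.l_inv[of x]
    additive.inv_inv[of x] additive.inv_mult_group[of x y] additive.m_assoc[of x y z]
  by (simp_all add: a_inv_def)

lemma minus_unique: "\<lbrakk>x \<oplus> y = \<zero>; x \<in> carrier B; y \<in> carrier B\<rbrakk> \<Longrightarrow> \<ominus> y = x"
  using additive.inv_equality[of x y] by (simp add: a_inv_def)

lemma minus_add_cancel [simp]: "\<lbrakk>x \<in> carrier B; y \<in> carrier B\<rbrakk> \<Longrightarrow> \<ominus> x \<oplus> (x \<oplus> y) = y"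
  and add_minus_cancel [simp]: "\<lbrakk>x \<in> carrier B; y \<in> carrier B\<rbrakk> \<Longrightarrow> x \<oplus> (\<ominus> x \<oplus> y) = y"
  by (simp_all add: add_assoc[symmetric])

abbreviation lam :: "'a \<Rightarrow> 'a \<Rightarrow> 'a" where
  "lam \<equiv> brace_lambda B"

lemma lam_closed [simp, intro]: "\<lbrakk>a \<in> carrier B; b \<in> carrier B\<rbrakk> \<Longrightarrow> lam a b \<in> carrier B"
  by (simp add: brace_lambda_def)

lemma circle_eq: "\<lbrakk>a \<in> carrier B; b \<in> carrier B\<rbrakk> \<Longrightarrow> a \<otimes> b = a \<oplus> lam a b"
  by (simp add: brace_lambda_def)

lemma lam_add:
  "\<lbrakk>a \<in> carrier B; b \<in> carrier B; c \<in> carrier B\<rbrakk> \<Longrightarrow> lam a (b \<oplus> c) = lam a b \<oplus> lam a c"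
  by (simp add: brace_lambda_def brace_law a_minus_def add_assoc)

lemma lam_circle:
  assumes "a \<in> carrier B" "b \<in> carrier B" "c \<in> carrier B"
  shows "lam (a \<otimes> b) c = lam a (lam b c)"
proof -
  have "(a \<otimes> b) \<otimes> c = a \<otimes> (b \<oplus> lam b c)"
    using assms circle.m_assoc[of a b c] circle_eq[of b c] by simp
  also have "\<dots> = (a \<otimes> b) \<oplus> lam a (lam b c)"
    using assms brace_law[of a b "lam b c"]
    by (simp add: a_minus_def add_assoc brace_lambda_def[of B a "lam b c"])
  finally show ?thesis using assms by (simp add: brace_lambda_def[of B "a \<otimes> b"])
qed

lemma one_eq_zero: "\<one> = \<zero>"
proof -
  have "\<zero> = \<ominus> \<one>"
    using brace_law[of \<one> \<zero> \<zero>] by (simp add: a_minus_def)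
  then show ?thesis by (metis add_minus circle.one_closed add_zero)
qed

lemma lam_one [simp]: "b \<in> carrier B \<Longrightarrow> lam \<one> b = b"
  using circle_eq[of \<one> b] circle.l_one[of b] one_eq_zero by simp

lemma lam_zero [simp]: "a \<in> carrier B \<Longrightarrow> lam a \<zero> = \<zero>"
  using circle.r_one[of a, unfolded one_eq_zero] by (simp add: brace_lambda_def)

lemma lam_minus: "\<lbrakk>a \<in> carrier B; b \<in> carrier B\<rbrakk> \<Longrightarrow> lam a (\<ominus> b) = \<ominus> lam a b"
  using lam_add[of a "\<ominus> b" b] minus_unique[of "lam a (\<ominus> b)" "lam a b"] by simp

lemma lam_lam_inv: "\<lbrakk>a \<in> carrier B; b \<in> carrier B\<rbrakk> \<Longrightarrow> lam a (lam (inv a) b) = b"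
  and lam_inv_lam: "\<lbrakk>a \<in> carrier B; b \<in> carrier B\<rbrakk> \<Longrightarrow> lam (inv a) (lam a b) = b"
  by (simp_all flip: lam_circle)

lemma left_brace_ideal_imp_sub_skew_brace:
  assumes "left_brace_ideal L B"
  shows "sub_skew_brace L B"
proof -
  interpret L: subgroup L "add_monoid B" using assms by (simp add: left_brace_ideal_def)
  have sub: "L \<subseteq> carrier B" using L.subset by simp
  have lam: "lam a x \<in> L" if "a \<in> carrier B" "x \<in> L" for a x
    using assms that by (auto simp: left_brace_ideal_def)
  have "subgroup L B"
  proof (rule circle.subgroupI)
    fix a assume a: "a \<in> L"
    then have aB: "a \<in> carrier B" using sub by blast
    have "lam a (inv a) = \<ominus> a"
      using aB by (simp add: brace_lambda_def one_eq_zero)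
    then have "inv a = lam (inv a) (\<ominus> a)" using lam_inv_lam[of a "inv a"] aB by simp
    moreover have "\<ominus> a \<in> L" using L.m_inv_closed[OF a] by (simp add: a_inv_def)
    ultimately show "inv a \<in> L" using lam[of "inv a" "\<ominus> a"] aB by simp
  next
    fix a b assume ab: "a \<in> L" "b \<in> L"
    then have c: "a \<in> carrier B" "b \<in> carrier B" using sub by auto
    show "a \<otimes> b \<in> L"
      using L.m_closed[OF ab(1) lam[OF c(1) ab(2)]] circle_eq[OF c] by simp
  qed (use sub L.one_closed in auto)
  then show ?thesis using L.subgroup_axioms by (simp add: sub_skew_brace_def)
qed

lemma sub_skew_brace_imp_skew_brace:
  assumes H: "sub_skew_brace H B"
  shows "skew_brace (B\<lparr>carrier := H\<rparr>)"
proof -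
  have s: "subgroup H (add_monoid B)" "subgroup H B" using H by (simp_all add: sub_skew_brace_def)
  have sub: "H \<subseteq> carrier B" using subgroup.subset[OF s(2)] .
  have "m_inv ((add_monoid B)\<lparr>carrier := H\<rparr>) x = m_inv (add_monoid B) x" if "x \<in> H" for x
    using additive.m_inv_consistent[OF s(1) that] .
  then have inv: "\<ominus>\<^bsub>B\<lparr>carrier := H\<rparr>\<^esub> x = \<ominus> x" if "x \<in> H" for x
    using that by (simp add: a_inv_def)
  have "Group.group (add_monoid (B\<lparr>carrier := H\<rparr>))"
    using additive.subgroup_imp_group[OF s(1)] by simp
  moreover have "Group.group (B\<lparr>carrier := H\<rparr>)"
    using circle.subgroup_imp_group[OF s(2)] .
  moreover have "skew_brace_axioms (B\<lparr>carrier := H\<rparr>)"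
    using brace_law sub by unfold_locales (auto simp: a_minus_def inv)
  ultimately show ?thesis by (simp add: skew_brace_def)
qed

lemma brace_lambda_sub:
  assumes H: "sub_skew_brace H B" and "a \<in> H"
  shows "brace_lambda (B\<lparr>carrier := H\<rparr>) a = lam a"
proof -
  have "subgroup H (add_monoid B)" using H by (simp_all add: sub_skew_brace_def)
  from additive.m_inv_consistent[OF this \<open>a \<in> H\<close>] show ?thesis
    by (simp add: fun_eq_iff brace_lambda_def a_inv_def)
qed

lemma left_brace_ideal_sub:
  assumes H: "sub_skew_brace H B" and L: "left_brace_ideal L B" "L \<subseteq> H"
  shows "left_brace_ideal L (B\<lparr>carrier := H\<rparr>)"
proof -
  have s: "subgroup H (add_monoid B)" "subgroup H B" using H by (simp_all add: sub_skew_brace_def)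
  have sub: "H \<subseteq> carrier B" using subgroup.subset[OF s(2)] .
  show ?thesis
    using additive.subgroup_incl[OF _ s(1)] L brace_lambda_sub[OF H] sub
    by (auto 0 3 simp: left_brace_ideal_def image_subset_iff)
qed

lemma brace_ideal_sub:
  assumes H: "sub_skew_brace H B" and I: "brace_ideal I B" "I \<subseteq> H"
  shows "brace_ideal I (B\<lparr>carrier := H\<rparr>)"
proof -
  have s: "subgroup H (add_monoid B)" "subgroup H B" using H by (simp_all add: sub_skew_brace_def)
  show ?thesis
    using left_brace_ideal_sub[OF H] I additive.normal_restrict_supergroup[OF s(1)]
      circle.normal_restrict_supergroup[OF s(2)]
    by (auto simp: brace_ideal_def)
qed

lemma sub_skew_brace_trans:
  assumes H: "sub_skew_brace H B" and K: "sub_skew_brace K (B\<lparr>carrier := H\<rparr>)"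
  shows "sub_skew_brace K B"
  using additive.incl_subgroup[of H K] circle.incl_subgroup[of H K] H K
  by (simp add: sub_skew_brace_def)

end


section \<open>Ideal factors of prime order\<close>

text \<open>
  The situation in which a complement has to be found: a factor \<open>I/N\<close> of prime order \<open>p\<close> below a
  factor \<open>B/I\<close> of order \<open>m\<close> prime to \<open>p\<close>.
\<close>
locale prime_section = skew_brace B for B :: "('a, 'b) ring_scheme" (structure) +
  fixes N I :: "'a set" and p m :: nat
  assumes fin: "finite (carrier B)"
    and N_ideal: "brace_ideal N B" and I_ideal: "brace_ideal I B" and N_le_I: "N \<subseteq> I"
    and p: "Factorial_Ring.prime p" and card_I: "card I = p * card N"
    and card_B: "card (carrier B) = m * card I" and p_m: "\<not> p dvd m"
begin

lemma prime_int: "Factorial_Ring.prime (int p)" and p_pos: "int p > 0" and m_unit: "\<not> [int m = 0] (mod int p)"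
  using p p_m prime_gt_0_nat by (auto simp: cong_0_iff)

lemma I_normal: "I \<lhd> add_monoid B" "I \<lhd> B" and N_normal: "N \<lhd> add_monoid B" "N \<lhd> B"
  using I_ideal N_ideal by (auto simp: brace_ideal_def)

lemma I_carrier: "x \<in> I \<Longrightarrow> x \<in> carrier B"
  using subgroup.subset[OF normal_imp_subgroup[OF I_normal(2)]] by blast

lemma N_carrier: "x \<in> N \<Longrightarrow> x \<in> carrier B"
  using N_le_I I_carrier by blast

lemma I_add: "\<lbrakk>x \<in> I; y \<in> I\<rbrakk> \<Longrightarrow> x \<oplus> y \<in> I"
  and I_minus: "x \<in> I \<Longrightarrow> \<ominus> x \<in> I"
  and I_circle: "\<lbrakk>x \<in> I; y \<in> I\<rbrakk> \<Longrightarrow> x \<otimes> y \<in> I"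
  and I_conj: "\<lbrakk>a \<in> carrier B; x \<in> I\<rbrakk> \<Longrightarrow> a \<oplus> x \<oplus> \<ominus> a \<in> I"
  and I_lam: "\<lbrakk>a \<in> carrier B; x \<in> I\<rbrakk> \<Longrightarrow> lam a x \<in> I"
proof -
  note s = normal_imp_subgroup[OF I_normal(1)] normal_imp_subgroup[OF I_normal(2)]
  show "\<lbrakk>x \<in> I; y \<in> I\<rbrakk> \<Longrightarrow> x \<oplus> y \<in> I" using subgroup.m_closed[OF s(1)] by simp
  show "x \<in> I \<Longrightarrow> \<ominus> x \<in> I" using subgroup.m_inv_closed[OF s(1)] by (simp add: a_inv_def)
  show "\<lbrakk>x \<in> I; y \<in> I\<rbrakk> \<Longrightarrow> x \<otimes> y \<in> I" using subgroup.m_closed[OF s(2)] by simp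
  show "\<lbrakk>a \<in> carrier B; x \<in> I\<rbrakk> \<Longrightarrow> a \<oplus> x \<oplus> \<ominus> a \<in> I"
    using normal.inv_op_closed2[OF I_normal(1)] by (simp add: a_inv_def)
  show "\<lbrakk>a \<in> carrier B; x \<in> I\<rbrakk> \<Longrightarrow> lam a x \<in> I"
    using I_ideal by (auto simp: brace_ideal_def left_brace_ideal_def)
qed

lemma N_add: "\<lbrakk>x \<in> N; y \<in> N\<rbrakk> \<Longrightarrow> x \<oplus> y \<in> N"
  and N_minus: "x \<in> N \<Longrightarrow> \<ominus> x \<in> N"
  and N_conj: "\<lbrakk>a \<in> carrier B; x \<in> N\<rbrakk> \<Longrightarrow> a \<oplus> x \<oplus> \<ominus> a \<in> N"
  and N_circle_conj: "\<lbrakk>a \<in> carrier B; x \<in> N\<rbrakk> \<Longrightarrow> a \<otimes> x \<otimes> inv a \<in> N"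
  and N_lam: "\<lbrakk>a \<in> carrier B; x \<in> N\<rbrakk> \<Longrightarrow> lam a x \<in> N"
proof -
  note s = normal_imp_subgroup[OF N_normal(1)] normal_imp_subgroup[OF N_normal(2)]
  show "\<lbrakk>x \<in> N; y \<in> N\<rbrakk> \<Longrightarrow> x \<oplus> y \<in> N" using subgroup.m_closed[OF s(1)] by simp
  show "x \<in> N \<Longrightarrow> \<ominus> x \<in> N" using subgroup.m_inv_closed[OF s(1)] by (simp add: a_inv_def)
  show "\<lbrakk>a \<in> carrier B; x \<in> N\<rbrakk> \<Longrightarrow> a \<oplus> x \<oplus> \<ominus> a \<in> N"
    using normal.inv_op_closed2[OF N_normal(1)] by (simp add: a_inv_def)
  show "\<lbrakk>a \<in> carrier B; x \<in> N\<rbrakk> \<Longrightarrow> a \<otimes> x \<otimes> inv a \<in> N"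
    using normal.inv_op_closed2[OF N_normal(2)] by simp
  show "\<lbrakk>a \<in> carrier B; x \<in> N\<rbrakk> \<Longrightarrow> lam a x \<in> N"
    using N_ideal by (auto simp: brace_ideal_def left_brace_ideal_def)
qed

lemma N_conj': "\<lbrakk>a \<in> carrier B; x \<in> N\<rbrakk> \<Longrightarrow> \<ominus> a \<oplus> x \<oplus> a \<in> N"
  using N_conj[of "\<ominus> a" x] by simp

text \<open>
  An ideal acts trivially modulo itself: \<open>n \<circ> b\<close> lies in \<open>b \<circ> N = b + N\<close>, as \<open>N\<close> is normal in the
  circle group, and removing \<open>n\<close> on the left does not leave this coset, as \<open>N\<close> is normal in the
  additive group.
\<close>
lemma lam_N:
  assumes n: "n \<in> N" and b: "b \<in> carrier B"
  obtains k where "k \<in> N" "lam n b = b \<oplus> k"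
proof -
  have nB: "n \<in> carrier B" using n N_carrier by blast
  define n' where "n' = inv b \<otimes> n \<otimes> b"
  have n': "n' \<in> N" "n' \<in> carrier B"
    using N_circle_conj[of "inv b" n] n b N_carrier by (auto simp: n'_def)
  have "b \<otimes> n' = n \<otimes> b" using nB b by (simp add: n'_def circle.m_assoc[symmetric])
  then have e: "lam n b = \<ominus> n \<oplus> (b \<oplus> lam b n')"
    using circle_eq[OF b n'(2)] by (simp add: brace_lambda_def[of B n])
  define k where "k = (\<ominus> b \<oplus> \<ominus> n \<oplus> b) \<oplus> lam b n'"
  have "k \<in> N" unfolding k_def using N_add N_conj'[OF b N_minus[OF n]] N_lam[OF b n'(1)] by blast
  moreover have "lam n b = b \<oplus> k" using e nB b n' by (simp add: k_def add_assoc)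
  ultimately show thesis using that by blast
qed

end

text \<open>
  The factor \<open>I/N\<close> is identified with the integers modulo \<open>p\<close> by \<open>\<theta>\<close>, and \<open>g\<close> is the element with
  coordinate \<open>1\<close>.
\<close>
locale coordinatized_section = prime_section +
  fixes \<theta> :: "'a \<Rightarrow> int" and g :: 'a
  assumes \<theta>_add: "\<lbrakk>x \<in> I; y \<in> I\<rbrakk> \<Longrightarrow> [\<theta> (x \<oplus> y) = \<theta> x + \<theta> y] (mod int p)"
    and \<theta>_kernel: "x \<in> I \<Longrightarrow> [\<theta> x = 0] (mod int p) \<longleftrightarrow> x \<in> N"
    and g: "g \<in> I" "[\<theta> g = 1] (mod int p)"
begin

lemma gB: "g \<in> carrier B" using g I_carrier by blast

lemma scalar:
  assumes "\<And>x y. \<lbrakk>x \<in> I; y \<in> I\<rbrakk> \<Longrightarrow> [\<psi> (x \<oplus> y) = \<psi> x + \<psi> y] (mod int p)"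
    and "\<And>x. x \<in> N \<Longrightarrow> [\<psi> x = 0] (mod int p)" and "x \<in> I"
  shows "[\<psi> x = \<psi> g * \<theta> x] (mod int p)"
proof -
  interpret A: group "(add_monoid B)\<lparr>carrier := I\<rparr>"
    using additive.subgroup_imp_group[OF normal_imp_subgroup[OF I_normal(1)]] .
  show ?thesis
    using A.hom_mod_prime_scalar[of \<theta> "int p" \<psi> g x] \<theta>_add \<theta>_kernel assms g p_pos by simp
qed

lemma \<theta>_onto:
  obtains x where "x \<in> I" "[\<theta> x = k] (mod int p)"
proof -
  interpret A: group "(add_monoid B)\<lparr>carrier := I\<rparr>"
    using additive.subgroup_imp_group[OF normal_imp_subgroup[OF I_normal(1)]] .
  have c: "crossed_hom (int p) ((add_monoid B)\<lparr>carrier := I\<rparr>) (\<lambda>_. 1) \<theta>"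
    using \<theta>_add by (auto intro: crossed_homI)
  define l where "l = nat (k mod int p)"
  have l: "[int l = k] (mod int p)" using p_pos by (simp add: l_def)
  have gA: "g \<in> carrier ((add_monoid B)\<lparr>carrier := I\<rparr>)" using g by simp
  have "[\<theta> (g [^]\<^bsub>(add_monoid B)\<lparr>carrier := I\<rparr>\<^esub> l) = int l * \<theta> g] (mod int p)"
    using A.crossed_hom_pow[OF c gA] by simp
  then have "[\<theta> (g [^]\<^bsub>(add_monoid B)\<lparr>carrier := I\<rparr>\<^esub> l) = k] (mod int p)"
    using l g(2) unfolding cong_equation by Groebner_Basis.algebra
  moreover have "g [^]\<^bsub>(add_monoid B)\<lparr>carrier := I\<rparr>\<^esub> l \<in> I"
    using A.nat_pow_closed[OF gA] by simp
  ultimately show thesis using that by blast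
qed

text \<open>
  The scalars by which \<open>a\<close> acts on \<open>I/N\<close>: through additive conjugation, and through \<open>\<lambda>\<^sub>a\<close>. They
  are read off from the action on \<open>g\<close>.
\<close>
definition \<chi> :: "'a \<Rightarrow> int" where "\<chi> a = \<theta> (a \<oplus> g \<oplus> \<ominus> a)"
definition \<mu> :: "'a \<Rightarrow> int" where "\<mu> a = \<theta> (lam a g)"

lemma \<chi>_conj:
  assumes a: "a \<in> carrier B" and x: "x \<in> I"
  shows "[\<theta> (a \<oplus> x \<oplus> \<ominus> a) = \<chi> a * \<theta> x] (mod int p)"
  unfolding \<chi>_def
proof (rule scalar[OF _ _ x])
  fix x y assume xy: "x \<in> I" "y \<in> I"
  have "a \<oplus> (x \<oplus> y) \<oplus> \<ominus> a = (a \<oplus> x \<oplus> \<ominus> a) \<oplus> (a \<oplus> y \<oplus> \<ominus> a)"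
    using a xy[THEN I_carrier] by (simp add: add_assoc)
  then show "[\<theta> (a \<oplus> (x \<oplus> y) \<oplus> \<ominus> a) = \<theta> (a \<oplus> x \<oplus> \<ominus> a) + \<theta> (a \<oplus> y \<oplus> \<ominus> a)] (mod int p)"
    using \<theta>_add I_conj a xy by simp
next
  fix x assume "x \<in> N"
  then show "[\<theta> (a \<oplus> x \<oplus> \<ominus> a) = 0] (mod int p)" using \<theta>_kernel N_conj[OF a] N_le_I by blast
qed

lemma \<mu>_lam:
  assumes a: "a \<in> carrier B" and x: "x \<in> I"
  shows "[\<theta> (lam a x) = \<mu> a * \<theta> x] (mod int p)"
  unfolding \<mu>_def
proof (rule scalar[OF _ _ x])
  fix x y assume xy: "x \<in> I" "y \<in> I"
  then show "[\<theta> (lam a (x \<oplus> y)) = \<theta> (lam a x) + \<theta> (lam a y)] (mod int p)"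
    using \<theta>_add[OF I_lam[OF a] I_lam[OF a]] a xy[THEN I_carrier] by (simp add: lam_add)
next
  fix x assume "x \<in> N"
  then show "[\<theta> (lam a x) = 0] (mod int p)" using \<theta>_kernel N_lam[OF a] N_le_I by blast
qed

lemma \<chi>_zero: "[\<chi> \<zero> = 1] (mod int p)"
  using g(2) gB additive.inv_one by (simp add: \<chi>_def a_inv_def)

lemma \<chi>_add:
  assumes "a \<in> carrier B" "b \<in> carrier B"
  shows "[\<chi> (a \<oplus> b) = \<chi> a * \<chi> b] (mod int p)"
proof -
  have "\<chi> (a \<oplus> b) = \<theta> (a \<oplus> (b \<oplus> g \<oplus> \<ominus> b) \<oplus> \<ominus> a)"
    using assms gB by (simp add: \<chi>_def add_assoc minus_sum)
  then show ?thesis using \<chi>_conj[OF assms(1) I_conj[OF assms(2) g(1)]] by (simp add: \<chi>_def[of b])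
qed

lemma \<chi>_I: 
  assumes "x \<in> I" shows "[\<chi> x = 1] (mod int p)"
proof -
  have x: "x \<in> carrier B" using assms I_carrier by blast
  have c: "x \<oplus> g \<oplus> \<ominus> x \<in> I" using I_conj[OF x g(1)] .
  have "(x \<oplus> g \<oplus> \<ominus> x) \<oplus> x = x \<oplus> g" using x gB by (simp add: add_assoc)
  then have "[\<chi> x + \<theta> x = \<theta> x + \<theta> g] (mod int p)"
    using \<theta>_add[OF c assms] \<theta>_add[OF assms g(1)] by (metis \<chi>_def cong_sym cong_trans)
  then show ?thesis using g(2) unfolding cong_equation by Groebner_Basis.algebra
qed

lemma \<mu>_one: "[\<mu> \<one> = 1] (mod int p)"
  using g(2) gB by (simp add: \<mu>_def)

lemma \<mu>_circle:
  assumes "a \<in> carrier B" "b \<in> carrier B"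
  shows "[\<mu> (a \<otimes> b) = \<mu> a * \<mu> b] (mod int p)"
  using \<mu>_lam[OF assms(1) I_lam[OF assms(2) g(1)]] assms gB by (simp add: \<mu>_def lam_circle)

lemma \<mu>_inv:
  assumes "a \<in> carrier B"
  shows "[\<mu> a * \<mu> (inv a) = 1] (mod int p)"
  using \<mu>_circle[of a "inv a"] \<mu>_one assms by (simp add: cong_sym_eq) (metis cong_trans)

text \<open>
  As \<open>\<lambda>\<^sub>a\<close> is an automorphism, conjugation by \<open>\<lambda>\<^sub>a b\<close> acts on \<open>I/N\<close> as the conjugate of the action
  of \<open>b\<close> by that of \<open>\<lambda>\<^sub>a\<close>, and scalars commute.
\<close>
lemma \<chi>_lam:
  assumes a: "a \<in> carrier B" and b: "b \<in> carrier B"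
  shows "[\<chi> (lam a b) = \<chi> b] (mod int p)"
proof -
  have "lam a b \<oplus> lam a g \<oplus> \<ominus> lam a b = lam a (b \<oplus> g \<oplus> \<ominus> b)"
    using a b gB by (simp add: lam_add lam_minus)
  then have "[\<chi> (lam a b) * \<mu> a = \<mu> a * \<chi> b] (mod int p)"
    using \<chi>_conj[OF lam_closed[OF a b] I_lam[OF a g(1)]] \<mu>_lam[OF a I_conj[OF b g(1)]]
    by (simp add: \<chi>_def[of b] \<mu>_def[of a]) (metis cong_sym cong_trans)
  then show ?thesis using \<mu>_inv[OF a] unfolding cong_equation by Groebner_Basis.algebra
qed

lemma \<theta>_circle:
  assumes x: "x \<in> I" and y: "y \<in> I"
  shows "[\<theta> (x \<otimes> y) = \<theta> x + \<mu> x * \<theta> y] (mod int p)"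
  unfolding circle_eq[OF I_carrier[OF x] I_carrier[OF y]]
  using \<theta>_add[OF x I_lam[OF I_carrier[OF x] y]] \<mu>_lam[OF I_carrier[OF x] y]
  unfolding cong_equation by Groebner_Basis.algebra

lemma \<mu>_N:
  assumes "n \<in> N" shows "[\<mu> n = 1] (mod int p)"
proof -
  obtain k where k: "k \<in> N" "lam n g = g \<oplus> k" using lam_N[OF assms gB] .
  then have "[\<mu> n = \<theta> g + \<theta> k] (mod int p)" "[\<theta> k = 0] (mod int p)"
    using \<theta>_add[OF g(1), of k] \<theta>_kernel N_le_I by (auto simp: \<mu>_def)
  then show ?thesis using g(2) unfolding cong_equation by Groebner_Basis.algebra
qed

text \<open>
  A skew brace of prime order is trivial. If \<open>\<mu> x \<noteq> 1\<close>, then left circle multiplication by \<open>x\<close> is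
  the affine map \<open>t \<mapsto> \<theta> x + \<mu> x t\<close> on \<open>I/N\<close>, which has a fixed point. A translation of a group
  with a fixed point is trivial, so \<open>x \<in> N\<close>; but elements of \<open>N\<close> have \<open>\<mu> x = 1\<close>.
\<close>
lemma \<mu>_I:
  assumes x: "x \<in> I" shows "[\<mu> x = 1] (mod int p)"
proof (rule ccontr)
  assume "\<not> [\<mu> x = 1] (mod int p)"
  then have "\<not> [1 - \<mu> x = 0] (mod int p)" by (simp add: cong_iff_dvd_diff dvd_diff_commute)
  then obtain v where v: "[(1 - \<mu> x) * v = 1] (mod int p)" using prime_cong_inverse[OF prime_int] by blast
  obtain y where y: "y \<in> I" "[\<theta> y = v * \<theta> x] (mod int p)" using \<theta>_onto .
  have xB: "x \<in> carrier B" and yB: "y \<in> carrier B" using x y I_carrier by auto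
  define k where "k = \<ominus> y \<oplus> (x \<otimes> y)"
  have k: "k \<in> I" "x \<otimes> y = y \<oplus> k" using I_add I_minus I_circle x y xB yB by (auto simp: k_def)
  have "[\<theta> k = 0] (mod int p)"
    using \<theta>_add[OF y(1) k(1), folded k(2)] \<theta>_circle[OF x y(1)] v y(2)
    unfolding cong_equation by Groebner_Basis.algebra
  then have kN: "k \<in> N" using \<theta>_kernel k by blast
  define n where "n = lam (inv y) k"
  have n: "n \<in> N" "n \<in> carrier B" using N_lam kN yB N_carrier by (auto simp: n_def)
  have "x \<otimes> y = y \<otimes> n" using k(2) circle_eq[OF yB n(2)] lam_lam_inv[OF yB] N_carrier[OF kN] by (simp add: n_def)
  then have "x = y \<otimes> n \<otimes> inv y" using xB yB n by (metis circle.inv_solve_right circle.m_closed)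
  then have "x \<in> N" using N_circle_conj[OF yB n(1)] by simp
  then show False using \<mu>_N \<open>\<not> [\<mu> x = 1] (mod int p)\<close> by blast
qed

lemma \<theta>_circle_hom: "\<lbrakk>x \<in> I; y \<in> I\<rbrakk> \<Longrightarrow> [\<theta> (x \<otimes> y) = \<theta> x + \<theta> y] (mod int p)"
  using \<theta>_circle[of x y] \<mu>_I[of x] unfolding cong_equation by simp Groebner_Basis.algebra

section \<open>Additive complements and the action on them\<close>

lemma additive_cocycle:
  obtains \<delta> where "crossed_hom (int p) (add_monoid B) \<chi> \<delta>" "\<And>x. x \<in> I \<Longrightarrow> [\<delta> x = \<theta> x] (mod int p)"
proof -
  have "[\<theta> (a \<otimes>\<^bsub>add_monoid B\<^esub> x \<otimes>\<^bsub>add_monoid B\<^esub> inv\<^bsub>add_monoid B\<^esub> a) = \<chi> a * \<theta> x] (mod int p)"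
    if "a \<in> carrier (add_monoid B)" "x \<in> I" for a x
    using \<chi>_conj that by (simp add: a_inv_def)
  then obtain \<delta> where "crossed_hom (int p) (add_monoid B) \<chi> \<delta>" "\<And>x. x \<in> I \<Longrightarrow> [\<delta> x = \<theta> x] (mod int p)"
    using additive.crossed_hom_extension[OF I_normal(1) _ prime_int _ m_unit, of \<theta> \<chi>]
      fin card_B \<theta>_add \<chi>_zero \<chi>_add by auto
  then show thesis using that by blast
qed

text \<open>
  In terms of complements: the subgroup \<open>Q\<close>, whose order is prime to \<open>p\<close>, is contained in some
  additive complement. The restriction to \<open>Q\<close> of any crossed homomorphism is principal, and the
  principal crossed homomorphism with the same parameter is subtracted on all of \<open>B\<close>; it vanishes
  on \<open>I\<close>.
\<close>
lemma additive_cocycle_vanishing: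
  assumes Q: "left_brace_ideal Q B" and pQ: "\<not> p dvd card Q"
  obtains \<delta> where "crossed_hom (int p) (add_monoid B) \<chi> \<delta>" "\<And>x. x \<in> I \<Longrightarrow> [\<delta> x = \<theta> x] (mod int p)"
    "\<And>x. x \<in> Q \<Longrightarrow> [\<delta> x = 0] (mod int p)"
proof -
  obtain d where d: "crossed_hom (int p) (add_monoid B) \<chi> d" "\<And>x. x \<in> I \<Longrightarrow> [d x = \<theta> x] (mod int p)"
    using additive_cocycle by blast
  have sQ: "subgroup Q (add_monoid B)" using Q by (simp add: left_brace_ideal_def)
  let ?Q = "(add_monoid B)\<lparr>carrier := Q\<rparr>"
  interpret Q: group ?Q using additive.subgroup_imp_group[OF sQ] .
  have dQ: "crossed_hom (int p) ?Q \<chi> d" by (rule additive.crossed_hom_subgroup[OF d(1) sQ])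
  have "\<exists>t. \<forall>x\<in>carrier ?Q. [d x = (1 - \<chi> x) * t] (mod int p)"
  proof (rule Q.crossed_hom_principal[OF dQ prime_int])
    fix x assume "x \<in> carrier ?Q"
    then have "x [^]\<^bsub>?Q\<^esub> card Q = \<one>\<^bsub>?Q\<^esub>" using Q.pow_order_eq_1[of x] by (simp add: order_def)
    then have "[d (x [^]\<^bsub>?Q\<^esub> card Q) = 0] (mod int p)" using Q.crossed_hom_one[OF dQ] by simp
    moreover have "\<not> [int (card Q) = 0] (mod int p)" using pQ by (simp add: cong_0_iff)
    ultimately show "\<exists>k::nat. \<not> [int k = 0] (mod int p) \<and> [d (x [^]\<^bsub>?Q\<^esub> k) = 0] (mod int p)" by blast
  qed
  then obtain t where t: "\<And>x. x \<in> Q \<Longrightarrow> [d x = (1 - \<chi> x) * t] (mod int p)" by auto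
  show thesis
  proof (rule that)
    show "crossed_hom (int p) (add_monoid B) \<chi> (\<lambda>x. d x + (1 - \<chi> x) * (- t))"
      by (rule additive.crossed_hom_add_principal[OF d(1)])
    show "[d x + (1 - \<chi> x) * - t = \<theta> x] (mod int p)" if "x \<in> I" for x
      using d(2)[OF that] \<chi>_I[OF that] unfolding cong_equation by Groebner_Basis.algebra
    show "[d x + (1 - \<chi> x) * - t = 0] (mod int p)" if "x \<in> Q" for x
      using t[OF that] unfolding cong_equation by Groebner_Basis.algebra
  qed
qed

lemma card_kernel:
  assumes G: "Group.group G" "carrier G = carrier B" and d: "crossed_hom (int p) G X d"
    and X: "\<And>x. x \<in> I \<Longrightarrow> [X x = 1] (mod int p)"
    and onto: "\<And>x. x \<in> I \<Longrightarrow> [d x = \<kappa> * \<theta> x] (mod int p)" and \<kappa>: "\<not> [\<kappa> = 0] (mod int p)"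
  shows "card {x \<in> carrier B. [d x = 0] (mod int p)} = m * card N"
proof -
  interpret G: group G by (rule G)
  obtain v where v: "[\<kappa> * v = 1] (mod int p)" using prime_cong_inverse[OF prime_int \<kappa>] .
  have "\<exists>x\<in>carrier G. [X x = 1] (mod int p) \<and> [d x = k] (mod int p)" for k
  proof -
    obtain x where x: "x \<in> I" "[\<theta> x = v * k] (mod int p)" using \<theta>_onto .
    have "[d x = k] (mod int p)"
      using onto[OF x(1)] x(2) v unfolding cong_equation by Groebner_Basis.algebra
    then show ?thesis using x X I_carrier G(2) by blast
  qed
  then have "card (carrier B) = p * card {x \<in> carrier B. [d x = 0] (mod int p)}"
    using G.card_crossed_hom_kernel[OF d p_pos] fin G(2) by simp
  then have "p * card {x \<in> carrier B. [d x = 0] (mod int p)} = p * (m * card N)"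
    using card_B card_I by (metis mult.left_commute)
  then show ?thesis using p by (metis mult_left_cancel not_prime_0)
qed

text \<open>
  The function \<open>f\<close> records how \<open>\<lambda>\<^sub>a\<close> moves the additive complement \<open>ker \<delta>\<close>. For fixed \<open>a\<close> the map
  \<open>b \<mapsto> \<delta> (\<lambda>\<^sub>a b) - \<mu> a \<delta> b\<close> is a crossed homomorphism for \<open>\<chi>\<close> that vanishes on \<open>I\<close>, and the
  \<open>m\<close>-th power of each element lies in \<open>I\<close>; hence it is principal.
\<close>
lemma lam_cocycle:
  assumes \<delta>: "crossed_hom (int p) (add_monoid B) \<chi> \<delta>" and \<delta>_I: "\<And>x. x \<in> I \<Longrightarrow> [\<delta> x = \<theta> x] (mod int p)"
  obtains f where "\<And>a b. \<lbrakk>a \<in> carrier B; b \<in> carrier B\<rbrakk> \<Longrightarrow>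
    [\<delta> (lam a b) = \<mu> a * \<delta> b + (1 - \<chi> b) * f a] (mod int p)"
proof -
  have "\<exists>t. \<forall>b\<in>carrier (add_monoid B). [\<delta> (lam a b) - \<mu> a * \<delta> b = (1 - \<chi> b) * t] (mod int p)"
    if a: "a \<in> carrier B" for a
  proof (rule additive.crossed_hom_principal[OF _ prime_int])
    show "crossed_hom (int p) (add_monoid B) \<chi> (\<lambda>b. \<delta> (lam a b) - \<mu> a * \<delta> b)"
    proof (rule crossed_homI)
      fix x y assume "x \<in> carrier (add_monoid B)" "y \<in> carrier (add_monoid B)"
      then have xy: "x \<in> carrier B" "y \<in> carrier B" by auto
      have "[\<delta> (lam a (x \<oplus> y)) = \<delta> (lam a x) + \<chi> (lam a x) * \<delta> (lam a y)] (mod int p)"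
        using additive.crossed_hom_mult[OF \<delta>, of "lam a x" "lam a y"] a xy by (simp add: lam_add)
      moreover have "[\<delta> (x \<oplus> y) = \<delta> x + \<chi> x * \<delta> y] (mod int p)"
        using additive.crossed_hom_mult[OF \<delta>, of x y] xy by simp
      ultimately have "[\<delta> (lam a (x \<oplus> y)) - \<mu> a * \<delta> (x \<oplus> y) =
        (\<delta> (lam a x) - \<mu> a * \<delta> x) + \<chi> x * (\<delta> (lam a y) - \<mu> a * \<delta> y)] (mod int p)"
        using \<chi>_lam[OF a xy(1)] unfolding cong_equation by Groebner_Basis.algebra
      then show "[\<delta> (lam a (x \<otimes>\<^bsub>add_monoid B\<^esub> y)) - \<mu> a * \<delta> (x \<otimes>\<^bsub>add_monoid B\<^esub> y) =
        (\<delta> (lam a x) - \<mu> a * \<delta> x) + \<chi> x * (\<delta> (lam a y) - \<mu> a * \<delta> y)] (mod int p)" by simp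
    qed (use \<chi>_zero \<chi>_add in auto)
  next
    fix x assume "x \<in> carrier (add_monoid B)"
    then have "x [^]\<^bsub>add_monoid B\<^esub> m \<in> I" (is "?y \<in> I")
      using additive.pow_index_mem_normal[OF I_normal(1)] fin card_B by simp
    then have "[\<delta> (lam a ?y) - \<mu> a * \<delta> ?y = 0] (mod int p)"
      using \<delta>_I[of ?y] \<delta>_I[OF I_lam[OF a], of ?y] \<mu>_lam[OF a, of ?y]
      unfolding cong_equation by simp Groebner_Basis.algebra
    then show "\<exists>k::nat. \<not> [int k = 0] (mod int p) \<and>
        [\<delta> (lam a (x [^]\<^bsub>add_monoid B\<^esub> k)) - \<mu> a * \<delta> (x [^]\<^bsub>add_monoid B\<^esub> k) = 0] (mod int p)"
      using m_unit by blast
  qed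
  then have "\<forall>a\<in>carrier B. \<exists>t. \<forall>b\<in>carrier B. [\<delta> (lam a b) - \<mu> a * \<delta> b = (1 - \<chi> b) * t] (mod int p)"
    by simp
  then obtain f where f: "\<forall>a\<in>carrier B. \<forall>b\<in>carrier B. [\<delta> (lam a b) - \<mu> a * \<delta> b = (1 - \<chi> b) * f a] (mod int p)"
    by metis
  show thesis
  proof (rule that[of f])
    fix a b assume "a \<in> carrier B" "b \<in> carrier B"
    with f have "[\<delta> (lam a b) - \<mu> a * \<delta> b = (1 - \<chi> b) * f a] (mod int p)" by blast
    then show "[\<delta> (lam a b) = \<mu> a * \<delta> b + (1 - \<chi> b) * f a] (mod int p)"
      unfolding cong_equation by Groebner_Basis.algebra
  qed
qed

section \<open>Complements that are sub-skew braces\<close>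

text \<open>
  An additive complement that all \<open>\<lambda>\<^sub>a\<close> preserve is a left ideal.
\<close>
lemma equivariant_kernel:
  assumes \<delta>: "crossed_hom (int p) (add_monoid B) \<chi> \<delta>" and \<delta>_I: "\<And>x. x \<in> I \<Longrightarrow> [\<delta> x = \<theta> x] (mod int p)"
    and eqv: "\<And>a b. \<lbrakk>a \<in> carrier B; b \<in> carrier B\<rbrakk> \<Longrightarrow> [\<delta> (lam a b) = \<mu> a * \<delta> b] (mod int p)"
  defines "K \<equiv> {x \<in> carrier B. [\<delta> x = 0] (mod int p)}"
  shows "sub_skew_brace K B" "card K = m * card N"
proof -
  have "lam a b \<in> K" if "a \<in> carrier B" "b \<in> K" for a b
  proof -
    have b: "b \<in> carrier B" "[\<delta> b = 0] (mod int p)" using that by (auto simp: K_def)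
    have "[\<delta> (lam a b) = 0] (mod int p)"
      using eqv[OF that(1) b(1)] b(2) unfolding cong_equation by Groebner_Basis.algebra
    then show ?thesis using that b by (simp add: K_def)
  qed
  then have "left_brace_ideal K B"
    using additive.crossed_hom_kernel_subgroup[OF \<delta>] by (auto simp: left_brace_ideal_def K_def)
  then show "sub_skew_brace K B" by (rule left_brace_ideal_imp_sub_skew_brace)
  have "\<not> [1 = 0] (mod int p)" using prime_gt_1_nat[OF p] by (simp add: cong_0_iff)
  then show "card K = m * card N" unfolding K_def
    using card_kernel[OF additive.is_group _ \<delta> \<chi>_I, of 1] \<delta>_I by simp
qed

text \<open>
  Here \<open>C = ker f\<close> is a circle complement that preserves the additive complement \<open>ker \<delta>\<close>. On \<open>C\<close>
  the function \<open>\<delta>\<close> is a crossed homomorphism of the circle group for the character \<open>\<chi> \<mu>\<close>, and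
  it is principal; its parameter \<open>t\<close> is the coset of \<open>ker \<delta>\<close> that \<open>C\<close> fixes. For \<open>i \<in> I\<close> with
  coordinate \<open>t\<close>, the additive subgroup \<open>K'\<close> and the circle subgroup \<open>C'\<close> below are obtained from
  \<open>ker \<delta>\<close> and \<open>C\<close> by pulling back along \<open>i\<close>. One contains the other, and they have the same order.
\<close>
lemma kernel_translate_sub_skew_brace:
  assumes \<delta>: "crossed_hom (int p) (add_monoid B) \<chi> \<delta>" and \<delta>_I: "\<And>x. x \<in> I \<Longrightarrow> [\<delta> x = \<theta> x] (mod int p)"
    and f: "\<And>a b. \<lbrakk>a \<in> carrier B; b \<in> carrier B\<rbrakk> \<Longrightarrow>
      [\<delta> (lam a b) = \<mu> a * \<delta> b + (1 - \<chi> b) * f a] (mod int p)"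
    and f_crossed: "crossed_hom (int p) B \<mu> f"
    and f_I: "\<And>x. x \<in> I \<Longrightarrow> [f x = \<kappa> * \<theta> x] (mod int p)" and \<kappa>: "\<not> [\<kappa> = 0] (mod int p)"
  shows "\<exists>i\<in>carrier B. sub_skew_brace {b \<in> carrier B. [\<delta> (lam i b) = 0] (mod int p)} B \<and>
    card {b \<in> carrier B. [\<delta> (lam i b) = 0] (mod int p)} = m * card N"
proof -
  have \<delta>_add: "[\<delta> (x \<oplus> y) = \<delta> x + \<chi> x * \<delta> y] (mod int p)" if "x \<in> carrier B" "y \<in> carrier B" for x y
    using additive.crossed_hom_mult[OF \<delta>, of x y] that by simp
  note f_mult = circle.crossed_hom_mult[OF f_crossed]
  define C where "C = {x \<in> carrier B. [f x = 0] (mod int p)}"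
  have C_sub: "subgroup C B" unfolding C_def by (rule circle.crossed_hom_kernel_subgroup[OF f_crossed])
  have CB: "c \<in> carrier B" "[f c = 0] (mod int p)" if "c \<in> C" for c using that by (auto simp: C_def)
  interpret C: group "B\<lparr>carrier := C\<rparr>" using circle.subgroup_imp_group[OF C_sub] .
  have \<delta>_C: "[\<delta> (c \<otimes> b) = \<delta> c + \<chi> c * \<mu> c * \<delta> b] (mod int p)" if "c \<in> C" "b \<in> carrier B" for c b
    unfolding circle_eq[OF CB(1)[OF that(1)] that(2)]
    using \<delta>_add[OF CB(1)[OF that(1)] lam_closed[OF CB(1)[OF that(1)] that(2)]]
      f[OF CB(1)[OF that(1)] that(2)] CB(2)[OF that(1)]
    unfolding cong_equation by Groebner_Basis.algebra
  have \<chi>_circle: "[\<chi> (a \<otimes> b) = \<chi> a * \<chi> b] (mod int p)" if "a \<in> carrier B" "b \<in> carrier B" for a b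
    unfolding circle_eq[OF that]
    using \<chi>_add[OF that(1) lam_closed[OF that]] \<chi>_lam[OF that]
    unfolding cong_equation by Groebner_Basis.algebra
  have \<delta>_crossed: "crossed_hom (int p) (B\<lparr>carrier := C\<rparr>) (\<lambda>x. \<chi> x * \<mu> x) \<delta>"
  proof (rule crossed_homI)
    show "[\<chi> \<one>\<^bsub>B\<lparr>carrier := C\<rparr>\<^esub> * \<mu> \<one>\<^bsub>B\<lparr>carrier := C\<rparr>\<^esub> = 1] (mod int p)"
      using \<chi>_zero[folded one_eq_zero] \<mu>_one unfolding cong_equation by simp Groebner_Basis.algebra
    fix x y assume xy: "x \<in> carrier (B\<lparr>carrier := C\<rparr>)" "y \<in> carrier (B\<lparr>carrier := C\<rparr>)"
    then have c: "x \<in> carrier B" "y \<in> carrier B" using CB by auto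
    have "[\<chi> (x \<otimes> y) * \<mu> (x \<otimes> y) = \<chi> x * \<mu> x * (\<chi> y * \<mu> y)] (mod int p)"
      using \<chi>_circle[OF c] \<mu>_circle[OF c] unfolding cong_equation by Groebner_Basis.algebra
    then show "[\<chi> (x \<otimes>\<^bsub>B\<lparr>carrier := C\<rparr>\<^esub> y) * \<mu> (x \<otimes>\<^bsub>B\<lparr>carrier := C\<rparr>\<^esub> y) = \<chi> x * \<mu> x * (\<chi> y * \<mu> y)] (mod int p)"
      by simp
    show "[\<delta> (x \<otimes>\<^bsub>B\<lparr>carrier := C\<rparr>\<^esub> y) = \<delta> x + \<chi> x * \<mu> x * \<delta> y] (mod int p)"
      using \<delta>_C xy c by simp
  qed
  have "\<exists>t. \<forall>c\<in>carrier (B\<lparr>carrier := C\<rparr>). [\<delta> c = (1 - \<chi> c * \<mu> c) * t] (mod int p)"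
  proof (rule C.crossed_hom_principal[OF \<delta>_crossed prime_int])
    fix x assume x: "x \<in> carrier (B\<lparr>carrier := C\<rparr>)"
    let ?y = "x [^]\<^bsub>B\<lparr>carrier := C\<rparr>\<^esub> m"
    have y: "?y \<in> C" using C.nat_pow_closed[OF x] by simp
    have "?y = x [^] m" by (rule circle.nat_pow_consistent[symmetric])
    then have yI: "?y \<in> I"
      using circle.pow_index_mem_normal[OF I_normal(2) fin card_B] CB(1) x by simp
    obtain u where u: "[\<kappa> * u = 1] (mod int p)" using prime_cong_inverse[OF prime_int \<kappa>] .
    \<comment> \<open>Since \<open>\<kappa>\<close> is a unit, \<open>C\<close> and \<open>I\<close> meet in \<open>N\<close>.\<close>
    have "[\<theta> ?y = 0] (mod int p)"
      using f_I[OF yI] CB(2)[OF y] u unfolding cong_equation by Groebner_Basis.algebra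
    then have "[\<delta> ?y = 0] (mod int p)" using \<delta>_I[OF yI] cong_trans by blast
    then show "\<exists>k::nat. \<not> [int k = 0] (mod int p) \<and> [\<delta> (x [^]\<^bsub>B\<lparr>carrier := C\<rparr>\<^esub> k) = 0] (mod int p)"
      using m_unit by blast
  qed
  then obtain t where t: "\<And>c. c \<in> C \<Longrightarrow> [\<delta> c = (1 - \<chi> c * \<mu> c) * t] (mod int p)" by auto
  obtain i where i: "i \<in> I" "[\<theta> i = t] (mod int p)" using \<theta>_onto .
  have iB: "i \<in> carrier B" using i I_carrier by blast
  have \<delta>_i: "[\<delta> i = t] (mod int p)" using \<delta>_I[OF i(1)] i(2) cong_trans by blast
  define K' where "K' = {b \<in> carrier B. [\<delta> (lam i b) = 0] (mod int p)}"
  define C' where "C' = {b \<in> carrier B. [f (i \<otimes> b \<otimes> inv i) = 0] (mod int p)}"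
  have K'_crossed: "crossed_hom (int p) (add_monoid B) \<chi> (\<lambda>b. \<delta> (lam i b))"
  proof (rule crossed_homI)
    fix x y assume "x \<in> carrier (add_monoid B)" "y \<in> carrier (add_monoid B)"
    then have xy: "x \<in> carrier B" "y \<in> carrier B" by auto
    have "[\<delta> (lam i x \<oplus> lam i y) = \<delta> (lam i x) + \<chi> x * \<delta> (lam i y)] (mod int p)"
      using \<delta>_add[OF lam_closed[OF iB xy(1)] lam_closed[OF iB xy(2)]] \<chi>_lam[OF iB xy(1)]
      unfolding cong_equation by Groebner_Basis.algebra
    then show "[\<delta> (lam i (x \<otimes>\<^bsub>add_monoid B\<^esub> y)) = \<delta> (lam i x) + \<chi> x * \<delta> (lam i y)] (mod int p)"
      using iB xy by (simp add: lam_add)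
  qed (use \<chi>_zero \<chi>_add in auto)
  have conj: "i \<otimes> b \<otimes> inv i \<in> carrier B" if "b \<in> carrier B" for b using that iB by simp
  have iinv: "inv i \<in> I" using i(1) normal_imp_subgroup[OF I_normal(2)] subgroup.m_inv_closed by metis
  have \<mu>_conj: "[\<mu> (i \<otimes> b \<otimes> inv i) = \<mu> b] (mod int p)" if "b \<in> carrier B" for b
    using \<mu>_circle[OF circle.m_closed[OF iB that] circle.inv_closed[OF iB]] \<mu>_circle[OF iB that]
      \<mu>_I[OF i(1)] \<mu>_I[OF iinv]
    unfolding cong_equation by Groebner_Basis.algebra
  have C'_crossed: "crossed_hom (int p) B \<mu> (\<lambda>b. f (i \<otimes> b \<otimes> inv i))"
  proof (rule crossed_homI)
    fix x y assume xy: "x \<in> carrier B" "y \<in> carrier B"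
    have e: "i \<otimes> (x \<otimes> y) \<otimes> inv i = (i \<otimes> x \<otimes> inv i) \<otimes> (i \<otimes> y \<otimes> inv i)"
      using iB xy by (simp add: circle.m_assoc) (simp add: circle.m_assoc[symmetric])
    show "[f (i \<otimes> (x \<otimes> y) \<otimes> inv i) = f (i \<otimes> x \<otimes> inv i) + \<mu> x * f (i \<otimes> y \<otimes> inv i)] (mod int p)"
      unfolding e using f_mult[OF conj[OF xy(1)] conj[OF xy(2)]] \<mu>_conj[OF xy(1)]
      unfolding cong_equation by Groebner_Basis.algebra
  qed (use \<mu>_one \<mu>_circle in auto)
  have K'_sub: "subgroup K' (add_monoid B)"
    using additive.crossed_hom_kernel_subgroup[OF K'_crossed] by (simp add: K'_def)
  have C'_sub: "subgroup C' B"
    using circle.crossed_hom_kernel_subgroup[OF C'_crossed] by (simp add: C'_def)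
  have "[\<delta> (lam i x) = 1 * \<theta> x] (mod int p)" if "x \<in> I" for x
    using \<delta>_I[OF I_lam[OF iB that]] \<mu>_lam[OF iB that] \<mu>_I[OF i(1)]
    unfolding cong_equation by Groebner_Basis.algebra
  moreover have "\<not> [1 = 0] (mod int p)" using prime_gt_1_nat[OF p] by (simp add: cong_0_iff)
  ultimately have card_K': "card K' = m * card N"
    unfolding K'_def using card_kernel[OF additive.is_group _ K'_crossed \<chi>_I, of 1] by simp
  have "[f (i \<otimes> x \<otimes> inv i) = \<kappa> * \<theta> x] (mod int p)" if x: "x \<in> I" for x
    using f_mult[OF circle.m_closed[OF iB I_carrier[OF x]] circle.inv_closed[OF iB]] f_mult[OF iB I_carrier[OF x]]
      f_mult[OF iB circle.inv_closed[OF iB], unfolded circle.r_inv[OF iB]] circle.crossed_hom_one[OF f_crossed]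
      \<mu>_I[OF i(1)] \<mu>_I[OF I_circle[OF i(1) x]] f_I[OF x]
    unfolding cong_equation by Groebner_Basis.algebra
  then have card_C': "card C' = m * card N"
    unfolding C'_def using card_kernel[OF circle.is_group _ C'_crossed \<mu>_I _ \<kappa>] by simp
  have "C' \<subseteq> K'"
  proof
    fix b assume b: "b \<in> C'"
    then have bB: "b \<in> carrier B" by (simp add: C'_def)
    define c where "c = i \<otimes> b \<otimes> inv i"
    have c: "c \<in> C" using b conj by (simp add: C_def C'_def c_def)
    have e: "c \<otimes> i = i \<oplus> lam i b"
      using iB bB circle_eq[OF iB bB] by (simp add: c_def circle.m_assoc)
    \<comment> \<open>Both \<open>c \<circ> i\<close> and \<open>i\<close> have \<open>\<delta>\<close>-value \<open>t\<close>: the coset of \<open>i\<close> is fixed by \<open>c\<close>.\<close>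
    have "[\<delta> (lam i b) = 0] (mod int p)"
      using \<delta>_C[OF c iB, unfolded e] \<delta>_add[OF iB lam_closed[OF iB bB]] \<delta>_i t[OF c] \<chi>_I[OF i(1)]
      unfolding cong_equation by Groebner_Basis.algebra
    then show "b \<in> K'" using bB by (simp add: K'_def)
  qed
  moreover have "finite K'" using fin by (simp add: K'_def)
  ultimately have "C' = K'" using card_K' card_C' by (simp add: card_subset_eq)
  then have "sub_skew_brace K' B" using K'_sub C'_sub by (simp add: sub_skew_brace_def)
  then show ?thesis using card_K' iB unfolding K'_def by blast
qed

text \<open>
  Either \<open>\<delta>\<close> is equivariant for all \<open>\<lambda>\<^sub>a\<close>, or some \<open>a0\<close> and \<open>b0\<close> witness the contrary. In the second
  case \<open>\<chi> b0 \<noteq> 1\<close> determines \<open>f\<close> uniquely, which makes \<open>f\<close> a crossed homomorphism; and \<open>f a0 \<noteq> 0\<close>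
  forces \<open>\<chi> = 1\<close> on the invariant set \<open>Q\<close>, so that \<open>\<delta>\<close> keeps vanishing on \<open>Q\<close> when a principal
  crossed homomorphism is added.
\<close>
lemma sub_skew_brace_complement_coordinatized:
  assumes Q: "left_brace_ideal Q B" and pQ: "\<not> p dvd card Q"
  shows "\<exists>K. sub_skew_brace K B \<and> N \<subseteq> K \<and> Q \<subseteq> K \<and> card K = m * card N"
proof -
  obtain \<delta> where \<delta>: "crossed_hom (int p) (add_monoid B) \<chi> \<delta>"
    and \<delta>_I: "\<And>x. x \<in> I \<Longrightarrow> [\<delta> x = \<theta> x] (mod int p)"
    and \<delta>_Q: "\<And>x. x \<in> Q \<Longrightarrow> [\<delta> x = 0] (mod int p)"
    using additive_cocycle_vanishing[OF Q pQ] by blast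
  have QB: "x \<in> carrier B" if "x \<in> Q" for x
    using Q that subgroup.subset[of Q "add_monoid B"] by (auto simp: left_brace_ideal_def)
  have Q_lam: "lam a x \<in> Q" if "a \<in> carrier B" "x \<in> Q" for a x
    using Q that by (auto simp: left_brace_ideal_def)
  have \<delta>_N: "[\<delta> x = 0] (mod int p)" if "x \<in> N" for x
    using \<delta>_I[of x] \<theta>_kernel[of x] that N_le_I cong_trans by blast
  have \<delta>_add: "[\<delta> (x \<oplus> y) = \<delta> x + \<chi> x * \<delta> y] (mod int p)" if "x \<in> carrier B" "y \<in> carrier B" for x y
    using additive.crossed_hom_mult[OF \<delta>, of x y] that by simp
  obtain f where f: "\<And>a b. \<lbrakk>a \<in> carrier B; b \<in> carrier B\<rbrakk> \<Longrightarrow>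
      [\<delta> (lam a b) = \<mu> a * \<delta> b + (1 - \<chi> b) * f a] (mod int p)"
    using lam_cocycle[OF \<delta> \<delta>_I] by blast
  have from_equivariant: ?thesis
    if eqv: "crossed_hom (int p) (add_monoid B) \<chi> d" "\<And>x. x \<in> I \<Longrightarrow> [d x = \<theta> x] (mod int p)"
      "\<And>a b. \<lbrakk>a \<in> carrier B; b \<in> carrier B\<rbrakk> \<Longrightarrow> [d (lam a b) = \<mu> a * d b] (mod int p)"
      and dQ: "\<And>x. x \<in> Q \<Longrightarrow> [d x = 0] (mod int p)" for d
  proof -
    let ?K = "{x \<in> carrier B. [d x = 0] (mod int p)}"
    have "x \<in> ?K" if "x \<in> N" for x
      using eqv(2)[of x] \<theta>_kernel[of x] that N_le_I N_carrier cong_trans by blast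
    then have "N \<subseteq> ?K" by blast
    moreover have "Q \<subseteq> ?K" using QB dQ by blast
    ultimately show ?thesis using equivariant_kernel[OF eqv] by blast
  qed
  show ?thesis
  proof (cases "\<forall>a\<in>carrier B. \<forall>b\<in>carrier B. [(1 - \<chi> b) * f a = 0] (mod int p)")
    case True
    have "[\<delta> (lam a b) = \<mu> a * \<delta> b] (mod int p)" if "a \<in> carrier B" "b \<in> carrier B" for a b
    proof -
      have "[(1 - \<chi> b) * f a = 0] (mod int p)" using True that by blast
      then show ?thesis using f[OF that] unfolding cong_equation by Groebner_Basis.algebra
    qed
    then show ?thesis using from_equivariant[OF \<delta> \<delta>_I] \<delta>_Q by blast
  next
    case False
    then obtain a0 b0 where ab0: "a0 \<in> carrier B" "b0 \<in> carrier B" "\<not> [(1 - \<chi> b0) * f a0 = 0] (mod int p)" by blast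
    then have nz: "\<not> [1 - \<chi> b0 = 0] (mod int p)" "\<not> [f a0 = 0] (mod int p)"
      by (auto simp: cong_0_iff)
    obtain v where v: "[(1 - \<chi> b0) * v = 1] (mod int p)" using prime_cong_inverse[OF prime_int nz(1)] .
    obtain w where w: "[f a0 * w = 1] (mod int p)" using prime_cong_inverse[OF prime_int nz(2)] .
    have \<chi>_Q: "[\<chi> x = 1] (mod int p)" if "x \<in> Q" for x
      using f[OF ab0(1) QB[OF that]] \<delta>_Q[OF that] \<delta>_Q[OF Q_lam[OF ab0(1) that]] w
      unfolding cong_equation by Groebner_Basis.algebra
    have f_mult: "[f (a \<otimes> b) = f a + \<mu> a * f b] (mod int p)" if "a \<in> carrier B" "b \<in> carrier B" for a b
      using f[OF circle.m_closed[OF that] ab0(2), unfolded lam_circle[OF that ab0(2)]]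
        f[OF that(2) ab0(2)] f[OF that(1) lam_closed[OF that(2) ab0(2)]]
        \<chi>_lam[OF that(2) ab0(2)] \<mu>_circle[OF that] v
      unfolding cong_equation by Groebner_Basis.algebra
    have f_crossed: "crossed_hom (int p) B \<mu> f" by (rule crossed_homI) (use \<mu>_one \<mu>_circle f_mult in auto)
    have f_N: "[f n = 0] (mod int p)" if n: "n \<in> N" for n
    proof -
      obtain k where k: "k \<in> N" "lam n b0 = b0 \<oplus> k" using lam_N[OF n ab0(2)] .
      show ?thesis
        using f[OF N_carrier[OF n] ab0(2), unfolded k(2)] \<delta>_add[OF ab0(2) N_carrier[OF k(1)]]
          \<delta>_N[OF k(1)] \<mu>_N[OF n] v
        unfolding cong_equation by Groebner_Basis.algebra
    qed
    have f_I: "[f x = f g * \<theta> x] (mod int p)" if "x \<in> I" for x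
    proof -
      interpret C: group "B\<lparr>carrier := I\<rparr>"
        using circle.subgroup_imp_group[OF normal_imp_subgroup[OF I_normal(2)]] .
      have "[f (x \<otimes> y) = f x + f y] (mod int p)" if "x \<in> I" "y \<in> I" for x y
        using f_mult[OF that[THEN I_carrier]] \<mu>_I[OF that(1)] unfolding cong_equation by Groebner_Basis.algebra
      then show ?thesis
        using C.hom_mod_prime_scalar[of \<theta> "int p" f g x] \<theta>_circle_hom \<theta>_kernel f_N g p_pos that by simp
    qed
    show ?thesis
    proof (cases "[f g = 0] (mod int p)")
      case True
      have "\<exists>t. \<forall>a\<in>carrier B. [f a = (1 - \<mu> a) * t] (mod int p)"
      proof (rule circle.crossed_hom_principal[OF f_crossed prime_int])
        fix x assume "x \<in> carrier B"
        then have "x [^] m \<in> I"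
          using circle.pow_index_mem_normal[OF I_normal(2) fin card_B] by blast
        then have "[f (x [^] m) = 0] (mod int p)"
          using f_I[of "x [^] m"] True unfolding cong_equation by simp Groebner_Basis.algebra
        then show "\<exists>k::nat. \<not> [int k = 0] (mod int p) \<and> [f (x [^] k) = 0] (mod int p)"
          using m_unit by blast
      qed
      then obtain t where t: "\<And>a. a \<in> carrier B \<Longrightarrow> [f a = (1 - \<mu> a) * t] (mod int p)" by blast
      show ?thesis
      proof (rule from_equivariant)
        show "crossed_hom (int p) (add_monoid B) \<chi> (\<lambda>x. \<delta> x + (1 - \<chi> x) * (- t))"
          by (rule additive.crossed_hom_add_principal[OF \<delta>])
        show "[\<delta> x + (1 - \<chi> x) * - t = \<theta> x] (mod int p)" if "x \<in> I" for x
          using \<delta>_I[OF that] \<chi>_I[OF that] unfolding cong_equation by Groebner_Basis.algebra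
        show "[\<delta> x + (1 - \<chi> x) * - t = 0] (mod int p)" if "x \<in> Q" for x
          using \<delta>_Q[OF that] \<chi>_Q[OF that] unfolding cong_equation by Groebner_Basis.algebra
        show "[\<delta> (lam a b) + (1 - \<chi> (lam a b)) * - t = \<mu> a * (\<delta> b + (1 - \<chi> b) * - t)] (mod int p)"
          if "a \<in> carrier B" "b \<in> carrier B" for a b
          using f[OF that] t[OF that(1)] \<chi>_lam[OF that] unfolding cong_equation by Groebner_Basis.algebra
      qed
    next
      case False
      obtain i where i: "i \<in> carrier B" and K: "sub_skew_brace {b \<in> carrier B. [\<delta> (lam i b) = 0] (mod int p)} B"
        and card_K: "card {b \<in> carrier B. [\<delta> (lam i b) = 0] (mod int p)} = m * card N"
        using kernel_translate_sub_skew_brace[OF \<delta> \<delta>_I f f_crossed f_I False] by blast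
      have "N \<subseteq> {b \<in> carrier B. [\<delta> (lam i b) = 0] (mod int p)}"
        using \<delta>_N[OF N_lam[OF i]] N_carrier by auto
      moreover have "Q \<subseteq> {b \<in> carrier B. [\<delta> (lam i b) = 0] (mod int p)}"
        using \<delta>_Q[OF Q_lam[OF i]] QB by auto
      ultimately show ?thesis using K card_K by blast
    qed
  qed
qed

end

lemma (in prime_section) exists_sub_skew_brace_complement:
  assumes "left_brace_ideal Q B" and "\<not> p dvd card Q"
  shows "\<exists>K. sub_skew_brace K B \<and> N \<subseteq> K \<and> Q \<subseteq> K \<and> card K = m * card N"
proof -
  let ?A = "(add_monoid B)\<lparr>carrier := I\<rparr>"
  have sI: "subgroup I (add_monoid B)" by (rule normal_imp_subgroup[OF I_normal(1)])
  interpret A: group ?A using additive.subgroup_imp_group[OF sI] .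
  have N: "N \<lhd> ?A" by (rule additive.normal_restrict_supergroup[OF sI N_normal(1) N_le_I])
  have finI: "finite I" using finite_subset[OF _ fin] I_carrier by blast
  obtain \<theta> g where \<theta>: "\<And>x y. \<lbrakk>x \<in> carrier ?A; y \<in> carrier ?A\<rbrakk> \<Longrightarrow> [\<theta> (x \<otimes>\<^bsub>?A\<^esub> y) = \<theta> x + \<theta> y] (mod (int p))"
    "\<And>x. x \<in> carrier ?A \<Longrightarrow> [\<theta> x = 0] (mod (int p)) \<longleftrightarrow> x \<in> N"
    "g \<in> carrier ?A" "[\<theta> g = 1] (mod (int p))"
    using A.prime_index_hom[OF N _ p] finI card_I by auto
  interpret coordinatized_section B N I p m \<theta> g
    by unfold_locales (use \<theta> in auto)
  show ?thesis using sub_skew_brace_complement_coordinatized[OF assms] .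
qed

section \<open>Descent along a chain of ideals\<close>

lemma (in skew_brace) order_section:
  assumes fin: "finite (carrier B)" and I: "brace_ideal I B" and J: "brace_ideal J B" and IJ: "I \<subseteq> J"
  shows "card J = order (B\<lparr>carrier := J\<rparr> Quot I) * card I"
proof -
  have s: "subgroup I (add_monoid B)" "subgroup J (add_monoid B)"
    using I J by (auto simp: brace_ideal_def left_brace_ideal_def)
  interpret A: group "(add_monoid B)\<lparr>carrier := J\<rparr>" using additive.subgroup_imp_group[OF s(2)] .
  have "finite J" using finite_subset[OF subgroup.subset[OF s(2)]] fin by simp
  then have "card (rcosets\<^bsub>(add_monoid B)\<lparr>carrier := J\<rparr>\<^esub> I) * card I = order ((add_monoid B)\<lparr>carrier := J\<rparr>)"
    using A.lagrange_finite additive.subgroup_incl[OF s IJ] by simp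
  then show ?thesis by (simp add: order_def FactRing_def A_RCOSETS_def)
qed

text \<open>
  The order of \<open>H\<close> is the maximum required because a \<open>\<pi>\<close>-number dividing \<open>m r\<close> is prime to
  \<open>r\<close> and so divides \<open>m\<close>.
\<close>
lemma hall_sub_skew_braceI:
  assumes H: "sub_skew_brace H B" and m: "card H = m" "pi_number \<pi> m" and order: "order B = m * r" "r > 0"
    and r: "\<And>p. \<lbrakk>Factorial_Ring.prime p; p dvd r\<rbrakk> \<Longrightarrow> p \<notin> \<pi>"
  shows "hall_sub_skew_brace \<pi> H B"
proof -
  have m0: "m > 0" using m by (simp add: pi_number_def)
  have "d \<le> m" if d: "pi_number \<pi> d" "d dvd order B" for d
  proof -
    have "coprime d r"
    proof (rule ccontr)
      assume "\<not> coprime d r"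
      then obtain q where "Factorial_Ring.prime q" "q dvd d" "q dvd r"
        using order(2) by (metis coprime_iff_gcd_eq_1 gcd_nat.bounded_iff prime_factor_nat)
      then show False using r d(1) by (auto simp: pi_number_def)
    qed
    then have "d dvd m" using d(2) order(1) by (simp add: coprime_dvd_mult_left_iff)
    then show ?thesis using m0 by (rule dvd_imp_le)
  qed
  moreover have "order B > 0" using m0 order by simp
  then have "finite {d. pi_number \<pi> d \<and> d dvd order B}"
    by (intro finite_subset[OF _ finite_divisors_nat[of "order B"]]) auto
  ultimately have "Max {d. pi_number \<pi> d \<and> d dvd order B} = m"
    using m order by (intro Max_eqI) auto
  then show ?thesis using H m by (simp add: hall_sub_skew_brace_def)
qed

theorem theorem19:
  fixes B :: "('a, 'b) ring_scheme" and \<pi> :: "nat set" and Q :: "'a set"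
  assumes "\<forall>p\<in>\<pi>. Factorial_Ring.prime p"
    and "skew_brace B" and "finite (carrier B)" and "supersoluble B"
    and "left_brace_ideal Q B" and "pi_number \<pi> (card Q)"
  shows "\<exists>H. hall_sub_skew_brace \<pi> H B \<and> Q \<subseteq> H"
proof -
  interpret skew_brace B by fact
  note fin = \<open>finite (carrier B)\<close> and Q = \<open>left_brace_ideal Q B\<close>
  obtain n :: nat and I where I0: "I 0 = {\<zero>\<^bsub>B\<^esub>}" and In: "I n = carrier B"
    and ideal: "\<And>j. j \<le> n \<Longrightarrow> brace_ideal (I j) B"
    and chain: "\<And>j. j < n \<Longrightarrow> I j \<subseteq> I (Suc j) \<and> Factorial_Ring.prime (order (B\<lparr>carrier := I (Suc j)\<rparr> Quot I j))"
    using \<open>supersoluble B\<close> unfolding supersoluble_def by blast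
  (* The invariant of the descent: H/I j is a Hall sub-skew brace of B/I j, with m its order and
     r its index. *)
  define hall_over where "hall_over j H m r \<longleftrightarrow> sub_skew_brace H B \<and> I j \<subseteq> H \<and> Q \<subseteq> H \<and>
      card H = m * card (I j) \<and> pi_number \<pi> m \<and> order B = card H * r \<and> r > 0 \<and>
      (\<forall>p. Factorial_Ring.prime p \<and> p dvd r \<longrightarrow> p \<notin> \<pi>)" for j H m and r :: nat
  have "\<exists>H m r. hall_over 0 H m r"
  proof (rule inc_induct[of 0 n])
    have "sub_skew_brace (carrier B) B"
      using additive.subgroup_self circle.subgroup_self by (simp add: sub_skew_brace_def)
    moreover have "Q \<subseteq> carrier B"
      using Q subgroup.subset[of Q "add_monoid B"] by (simp add: left_brace_ideal_def)
    ultimately have "hall_over n (carrier B) 1 1"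
      using In by (simp add: hall_over_def pi_number_def order_def)
    then show "\<exists>H m r. hall_over n H m r" by blast
  next
    fix j assume j: "j < n" and "\<exists>H m r. hall_over (Suc j) H m r"
    then obtain H m r where "hall_over (Suc j) H m r" by blast
    then have H: "sub_skew_brace H B" "I (Suc j) \<subseteq> H" "Q \<subseteq> H" "card H = m * card (I (Suc j))"
      and m: "pi_number \<pi> m" and r: "order B = card H * r" "r > 0"
        "\<And>p. \<lbrakk>Factorial_Ring.prime p; p dvd r\<rbrakk> \<Longrightarrow> p \<notin> \<pi>"
      by (auto simp: hall_over_def)
    define p where "p = order (B\<lparr>carrier := I (Suc j)\<rparr> Quot I j)"
    have p: "Factorial_Ring.prime p" and le: "I j \<subseteq> I (Suc j)" using chain[OF j] by (auto simp: p_def)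
    have ideals: "brace_ideal (I j) B" "brace_ideal (I (Suc j)) B" using ideal j by auto
    have card: "card (I (Suc j)) = p * card (I j)"
      unfolding p_def by (rule order_section[OF fin ideals le])
    show "\<exists>H m r. hall_over j H m r"
    proof (cases "p \<in> \<pi>")
      case True
      have "pi_number \<pi> (m * p)"
        using m p True prime_gt_0_nat[OF p]
        by (auto simp: pi_number_def prime_dvd_mult_iff dest: primes_dvd_imp_eq)
      then have "hall_over j H (m * p) r"
        using H r le card by (auto simp: hall_over_def)
      then show ?thesis by blast
    next
      case False
      have HB: "H \<subseteq> carrier B" using H(1) subgroup.subset[of H B] by (simp add: sub_skew_brace_def)
      let ?H = "B\<lparr>carrier := H\<rparr>"
      interpret H: skew_brace ?H by (rule sub_skew_brace_imp_skew_brace[OF H(1)])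
      have "\<not> p dvd m" "\<not> p dvd card Q"
        using False m \<open>pi_number \<pi> (card Q)\<close> p by (auto simp: pi_number_def)
      then interpret prime_section ?H "I j" "I (Suc j)" p m
        using brace_ideal_sub[OF H(1) ideals(1)] brace_ideal_sub[OF H(1) ideals(2) H(2)] H(2,4) le p card
          finite_subset[OF HB fin]
        by unfold_locales auto
      obtain K where K: "sub_skew_brace K ?H" "I j \<subseteq> K" "Q \<subseteq> K" "card K = m * card (I j)"
        using exists_sub_skew_brace_complement[OF left_brace_ideal_sub[OF H(1) Q H(3)] \<open>\<not> p dvd card Q\<close>] by blast
      have "order B = card K * (p * r)" using r(1) H(4) K(4) card by simp
      moreover have "q \<notin> \<pi>" if "Factorial_Ring.prime q" "q dvd p * r" for q
        using that p r(3) False by (auto simp: prime_dvd_mult_iff dest: primes_dvd_imp_eq)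
      ultimately have "hall_over j K m (p * r)"
        using K sub_skew_brace_trans[OF H(1) K(1)] m r(2) prime_gt_0_nat[OF p] by (auto simp: hall_over_def)
      then show ?thesis by blast
    qed
  qed simp
  then obtain H m r where "hall_over 0 H m r" by blast
  then have "hall_sub_skew_brace \<pi> H B \<and> Q \<subseteq> H"
    using hall_sub_skew_braceI[of H B m \<pi> r] I0 by (auto simp: hall_over_def)
  then show ?thesis by blast
qed

end
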